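(* Let $k = \sup\{k(P) : P \text{ is a finite packing of balls in } \mathbb{R}^3\}$ be the supremal average kissing number in dimension three. Then $$12.566 \approx \frac{666}{53} \le k < 8 + 4\sqrt{3} \approx 14.928.$$
   Context: A packing of balls in $\mathbb{R}^3$ is a collection of (closed, round) balls of positive radius in $\mathbb{R}^3$ with pairwise disjoint interiors; the balls may have different radii. For a finite packing $P$ consisting of $n \ge 1$ balls, the average kissing number of $P$ is $k(P) = 2m/n$, where $m$ is the number of tangencies between balls in the packing, i.e. the number of unordered pairs of distinct balls of $P$ that touch (have non-empty intersection). *)

theory Defs
  imports "HOL-Analysis.Analysis" "HOL-Library.Extended_Real"
begin

text \<open>
  Balls are point sets. No multiplicities are lost in taking a packing to be a set of balls:
  balls of positive radius with disjoint interiors are distinct.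
\<close>

definition ball_packing :: "(real ^ 3) set set \<Rightarrow> bool" where
  "ball_packing P \<longleftrightarrow>
     (\<forall>B\<in>P. \<exists>x r. r > 0 \<and> B = cball x r) \<and>
     pairwise (\<lambda>A B. interior A \<inter> interior B = {}) P"

definition tangencies :: "(real ^ 3) set set \<Rightarrow> (real ^ 3) set set set" where
  "tangencies P = {{A, B} | A B. A \<in> P \<and> B \<in> P \<and> A \<noteq> B \<and> A \<inter> B \<noteq> {}}"

definition average_kissing_number :: "(real ^ 3) set set \<Rightarrow> real" where
  "average_kissing_number P = 2 * real (card (tangencies P)) / real (card P)"

text \<open>
  The supremum is taken in the extended reals, because the real \<open>Sup\<close> of a set that is not
  bounded above is an unspecified real number.
\<close>

definition sup_average_kissing_number :: ereal where
  "sup_average_kissing_number =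
     Sup {ereal (average_kissing_number P) | P. finite P \<and> P \<noteq> {} \<and> ball_packing P}"

end

theory Submission
  imports Defs "HOL-Real_Asymp.Real_Asymp"
begin

text \<open>
  Upper bound. Around a ball of radius \<open>r\<close> draw the concentric sphere of radius \<open>sqrt 3 * r\<close>. A
  tangent ball of radius \<open>s\<close> cuts out a cap of height parameter
  \<open>h = (2 * r + s) / (sqrt 3 * (r + s))\<close>, which covers the fraction \<open>(1 - h) / 2\<close> of that sphere
  (nothing if \<open>h \<ge> 1\<close>). The caps are disjoint, and exchanging the two balls turns \<open>h\<close> into
  \<open>sqrt 3 - h\<close>, so every tangency uses up at least \<open>1 - sqrt 3 / 2\<close> of the total covered fraction.
  Strictness: a bounded number of disjoint caps cannot cover a sphere, because infinitely many
  points of the bounding circle of one cap would have to lie in the other closed caps, and each of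
  those meets the circle at most once; by compactness a fixed fraction stays uncovered.

  Lower bound. The vertices of the 600-cell are the centres of 120 equal caps on the 3-sphere, each
  touching 12 others. Project stereographically from a vertex, deleting it and its antipode. The
  innermost and outermost layers of the resulting balls are 12 balls each, in homothetic positions,
  so scaled copies can be chained, each sharing one layer with the next. Every further copy
  contributes 106 balls and 666 tangencies.
\<close>

section \<open>Tangent balls\<close>

text \<open>The map from \<open>(A, B)\<close> to \<open>{A, B}\<close> is two-to-one onto the
  tangencies. Both bounds count ordered pairs: a tangency gives one cap on each of its two balls,
  and the edges of the 600-cell are enumerated in both orders.\<close>

lemma card_ordered_tangencies:
  assumes "finite P"
  shows "card {(A, B). A \<in> P \<and> B \<in> P \<and> A \<noteq> B \<and> A \<inter> B \<noteq> {}} = 2 * card (tangencies P)"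
proof -
  define R where "R = {(A, B). A \<in> P \<and> B \<in> P \<and> A \<noteq> B \<and> A \<inter> B \<noteq> {}}"
  define pr where "pr = (\<lambda>(A, B). {A, B :: (real^3) set})"
  have fin: "finite R"
    by (rule finite_subset[of _ "P \<times> P"]) (auto simp: R_def assms)
  have img: "pr ` R = tangencies P"
  proof (intro set_eqI iffI)
    fix T assume "T \<in> pr ` R"
    then obtain A B where "(A, B) \<in> R" "T = {A, B}" by (auto simp only: pr_def split: prod.splits)
    then show "T \<in> tangencies P" unfolding R_def tangencies_def by blast
  next
    fix T assume "T \<in> tangencies P"
    then obtain A B where "(A, B) \<in> R" "T = pr (A, B)"
      unfolding R_def tangencies_def pr_def by blast
    then show "T \<in> pr ` R" by blast
  qed
  have fibre: "card {p \<in> R. pr p = T} = 2" if T: "T \<in> tangencies P" for T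
  proof -
    obtain A B where AB: "T = {A, B}" "A \<in> P" "B \<in> P" "A \<noteq> B" "A \<inter> B \<noteq> {}"
      using T unfolding tangencies_def by blast
    have "{p \<in> R. pr p = T} = {(A, B), (B, A)}"
    proof (intro set_eqI iffI)
      fix p assume "p \<in> {p \<in> R. pr p = T}"
      then have "{fst p, snd p} = {A, B}" using AB(1) by (simp add: pr_def split_beta)
      then show "p \<in> {(A, B), (B, A)}" by (cases p) (auto simp only: doubleton_eq_iff fst_conv snd_conv)
    next
      fix p assume "p \<in> {(A, B), (B, A)}"
      then consider "p = (A, B)" | "p = (B, A)" by blast
      then show "p \<in> {p \<in> R. pr p = T}"
        using AB by cases (simp_all only: R_def pr_def mem_Collect_eq prod.case, auto)
    qed
    then show ?thesis using AB by simp
  qed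
  have "card R = (\<Sum>T\<in>pr ` R. card {p \<in> R. pr p = T})"
    using sum.image_gen[OF fin, of "\<lambda>_. 1::nat" pr] by simp
  also have "\<dots> = 2 * card (tangencies P)"
    unfolding img using fibre by simp
  finally show ?thesis by (simp add: R_def)
qed

text \<open>If the centres are closer than \<open>r + s\<close>, the point dividing the segment
  between them in the ratio \<open>r : s\<close> is interior to both balls.\<close>

lemma disjoint_interior_cball_iff:
  fixes x y :: "'a::euclidean_space"
  assumes "r > 0" "s > 0"
  shows "interior (cball x r) \<inter> interior (cball y s) = {} \<longleftrightarrow> r + s \<le> dist x y"
proof
  assume disj: "interior (cball x r) \<inter> interior (cball y s) = {}"
  show "r + s \<le> dist x y"
  proof (rule ccontr)
    assume "\<not> r + s \<le> dist x y"
    then have lt: "dist x y < r + s" by simp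
    define t where "t = r / (r + s)"
    define z where "z = x + t *\<^sub>R (y - x)"
    have t: "0 < t" "t < 1" using assms by (auto simp: t_def)
    have tr: "t * (r + s) = r" using assms by (simp add: t_def)
    have "dist x z = t * dist x y"
      using t by (simp add: z_def dist_norm norm_minus_commute[of x y])
    also have "\<dots> < t * (r + s)" using t lt by simp
    also note tr
    finally have 1: "dist x z < r" .
    have "y - z = (1 - t) *\<^sub>R (y - x)" by (simp add: z_def algebra_simps)
    then have "dist y z = (1 - t) * dist x y"
      using t by (simp add: dist_norm norm_minus_commute[of x y])
    also have "\<dots> < (1 - t) * (r + s)" using t lt by simp
    also have "\<dots> = s" using tr by (simp add: left_diff_distrib)
    finally show False using 1 disj by (auto simp: interior_cball)
  qed
qed (simp add: interior_cball disjoint_ballI)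

text \<open>The same dividing point serves for closed balls. Together the two criteria say that two
  balls of a packing touch exactly when their centres are at distance \<open>r + s\<close>.\<close>

lemma cball_Int_cball_eq_empty_iff:
  fixes x y :: "'a::euclidean_space"
  assumes "r > 0" "s > 0"
  shows "cball x r \<inter> cball y s = {} \<longleftrightarrow> r + s < dist x y"
proof
  assume disj: "cball x r \<inter> cball y s = {}"
  show "r + s < dist x y"
  proof (rule ccontr)
    assume "\<not> r + s < dist x y"
    then have le: "dist x y \<le> r + s" by simp
    define t where "t = r / (r + s)"
    define z where "z = x + t *\<^sub>R (y - x)"
    have t: "0 < t" "t < 1" using assms by (auto simp: t_def)
    have tr: "t * (r + s) = r" using assms by (simp add: t_def)
    have "dist x z = t * dist x y"
      using t by (simp add: z_def dist_norm norm_minus_commute[of x y])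
    also have "\<dots> \<le> t * (r + s)" using t le by simp
    also note tr
    finally have 1: "dist x z \<le> r" .
    have "y - z = (1 - t) *\<^sub>R (y - x)" by (simp add: z_def algebra_simps)
    then have "dist y z = (1 - t) * dist x y"
      using t by (simp add: dist_norm norm_minus_commute[of x y])
    also have "\<dots> \<le> (1 - t) * (r + s)" using t le by simp
    also have "\<dots> = s" using tr by (simp add: left_diff_distrib)
    finally show False using 1 disj by auto
  qed
qed (simp add: disjoint_cballI)

section \<open>Volume of spherical sectors\<close>

lemma sector_slice_nonneg:
  assumes "0 < h" "h \<le> 1" "t \<in> {0..1::real}"
  shows "0 \<le> min (1 - t\<^sup>2) (t\<^sup>2 * (1 / h\<^sup>2 - 1))"
proof -
  have "t\<^sup>2 \<le> 1" "h\<^sup>2 \<le> 1" using assms by (auto intro: power_le_one)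
  then have "1 \<le> 1 / h\<^sup>2" using assms by simp
  with \<open>t\<^sup>2 \<le> 1\<close> show ?thesis by simp
qed

text \<open>Here \<open>m\<close> is the distance from the axis and \<open>t\<close> the height
  along it. Membership in the ball gives the bound \<open>1 - t\<^sup>2\<close> for
  \<open>m\<^sup>2\<close>, membership in the cone the other one; the slice at height
  \<open>t\<close> is thus an open disc.\<close>

lemma sector_slice_iff:
  fixes m t h :: real
  assumes h: "0 < h" "h \<le> 1" and m: "0 \<le> m"
  shows "sqrt (m\<^sup>2 + t\<^sup>2) < 1 \<and> h * sqrt (m\<^sup>2 + t\<^sup>2) < t \<longleftrightarrow>
    t \<in> {0..1} \<and> m < sqrt (min (1 - t\<^sup>2) (t\<^sup>2 * (1 / h\<^sup>2 - 1)))"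
proof (cases "t \<ge> 0")
  case True
  define w where "w = sqrt (m\<^sup>2 + t\<^sup>2)"
  have w: "w \<ge> 0" "w\<^sup>2 = m\<^sup>2 + t\<^sup>2" by (simp_all add: w_def)
  have m2: "m < sqrt x \<longleftrightarrow> m\<^sup>2 < x" for x
    using real_sqrt_less_iff[of "m\<^sup>2" x] m by simp
  have 1: "w < 1 \<longleftrightarrow> m\<^sup>2 < 1 - t\<^sup>2"
    unfolding w_def by (simp add: algebra_simps)
  have "h * w < t \<longleftrightarrow> (h * w)\<^sup>2 < t\<^sup>2"
    using True h w(1) abs_le_square_iff[of t "h * w"] by (simp add: not_le[symmetric])
  also have "\<dots> \<longleftrightarrow> h\<^sup>2 * (m\<^sup>2 + t\<^sup>2) < t\<^sup>2" by (simp add: power_mult_distrib w)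
  also have "\<dots> \<longleftrightarrow> m\<^sup>2 + t\<^sup>2 < t\<^sup>2 / h\<^sup>2"
    using h by (simp add: pos_less_divide_eq mult.commute)
  also have "\<dots> \<longleftrightarrow> m\<^sup>2 < t\<^sup>2 * (1 / h\<^sup>2 - 1)"
    by (auto simp: right_diff_distrib)
  finally have 2: "h * w < t \<longleftrightarrow> m\<^sup>2 < t\<^sup>2 * (1 / h\<^sup>2 - 1)" .
  have "t \<le> 1" if "m\<^sup>2 < 1 - t\<^sup>2"
  proof -
    have "t\<^sup>2 \<le> 1\<^sup>2" using that zero_le_power2[of m] unfolding one_power2 by linarith
    then show ?thesis by (rule power2_le_imp_le) simp
  qed
  then show ?thesis
    unfolding w_def[symmetric] 1 2 m2 using True by auto
next
  case False
  moreover have "0 \<le> h * sqrt (m\<^sup>2 + t\<^sup>2)" using h by simp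
  ultimately show ?thesis by auto
qed

text \<open>The minimum changes branch at \<open>t = h\<close>: below lies a straight cone, above a
  spherical cap, and both parts have polynomial antiderivatives.\<close>

lemma nn_integral_sector_slices:
  assumes h: "0 < h" "h \<le> 1"
  shows "(\<integral>\<^sup>+t. indicator {0..1} t * ennreal (pi * min (1 - t\<^sup>2) (t\<^sup>2 * (1 / h\<^sup>2 - 1))) \<partial>lborel) =
    ennreal (2 / 3 * pi * (1 - h))"
proof -
  let ?f = "\<lambda>t::real. pi * min (1 - t\<^sup>2) (t\<^sup>2 * (1 / h\<^sup>2 - 1))"
  have cmp: "t\<^sup>2 * (1 / h\<^sup>2 - 1) \<le> 1 - t\<^sup>2 \<longleftrightarrow> t \<le> h" if "t \<ge> 0" for t
  proof -
    have "t\<^sup>2 * (1 / h\<^sup>2 - 1) \<le> 1 - t\<^sup>2 \<longleftrightarrow> t\<^sup>2 \<le> h\<^sup>2"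
      using h by (simp add: field_simps)
    also have "\<dots> \<longleftrightarrow> t \<le> h" using h that by (simp add: abs_le_square_iff[symmetric])
    finally show ?thesis .
  qed
  have "((\<lambda>t. pi * (t\<^sup>2 * (1 / h\<^sup>2 - 1))) has_integral
      (pi * (h^3 / 3 * (1 / h\<^sup>2 - 1)) - pi * (0^3 / 3 * (1 / h\<^sup>2 - 1)))) {0..h}"
    using h by (intro fundamental_theorem_of_calculus)
      (auto intro!: derivative_eq_intros simp: has_real_derivative_iff_has_vector_derivative[symmetric] power2_eq_square)
  then have 1: "(?f has_integral
      (pi * (h^3 / 3 * (1 / h\<^sup>2 - 1)) - pi * (0^3 / 3 * (1 / h\<^sup>2 - 1)))) {0..h}"
  proof (rule has_integral_eq[rotated])
    fix t assume "t \<in> {0..h}"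
    then show "pi * (t\<^sup>2 * (1 / h\<^sup>2 - 1)) = ?f t"
      using cmp[of t] by (simp add: min_absorb2)
  qed
  have "((\<lambda>t. pi * (1 - t\<^sup>2)) has_integral (pi * (1 - 1^3 / 3) - pi * (h - h^3 / 3))) {h..1}"
    using h by (intro fundamental_theorem_of_calculus)
      (auto intro!: derivative_eq_intros simp: has_real_derivative_iff_has_vector_derivative[symmetric] power2_eq_square)
  then have 2: "(?f has_integral (pi * (1 - 1^3 / 3) - pi * (h - h^3 / 3))) {h..1}"
  proof (rule has_integral_eq[rotated])
    fix t assume t: "t \<in> {h..1}"
    with h have "t \<ge> 0" by auto
    from cmp[OF this] t show "pi * (1 - t\<^sup>2) = ?f t"
      using h by (cases "t = h") (auto simp: min_def field_simps)
  qed
  have "(?f has_integral ((pi * (h^3 / 3 * (1 / h\<^sup>2 - 1)) - pi * (0^3 / 3 * (1 / h\<^sup>2 - 1))) +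
      (pi * (1 - 1^3 / 3) - pi * (h - h^3 / 3)))) {0..1}"
    by (rule has_integral_combine[OF _ _ 1 2]) (use h in auto)
  also have "(pi * (h^3 / 3 * (1 / h\<^sup>2 - 1)) - pi * (0^3 / 3 * (1 / h\<^sup>2 - 1))) +
      (pi * (1 - 1^3 / 3) - pi * (h - h^3 / 3)) = 2 / 3 * pi * (1 - h)"
    using h by (simp add: field_simps power2_eq_square power3_eq_cube)
  finally have I: "(?f has_integral 2 / 3 * pi * (1 - h)) {0..1}" .
  have nn: "0 \<le> ?f t" if "t \<in> {0..1}" for t
    using sector_slice_nonneg[OF h that] by simp
  have "(\<integral>\<^sup>+t. indicator {0..1} t * ennreal (?f t) \<partial>lborel) = (\<integral>\<^sup>+t. ennreal (indicator {0..1} t * ?f t) \<partial>lborel)"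
    by (intro nn_integral_cong) (auto simp: indicator_def)
  also have "\<dots> = ennreal (2 / 3 * pi * (1 - h))"
    by (rule nn_integral_has_integral_lebesgue[OF nn I])
  finally show ?thesis .
qed

text \<open>For a unit vector \<open>u\<close> this is the open cone over the cap with centre
  \<open>u\<close> and angular radius \<open>arccos h\<close>, cut off by the unit ball. Its share
  of the volume of the ball is the share of the cap in the sphere, so Lebesgue measure can replace
  surface area.\<close>

definition sector :: "'a::real_inner \<Rightarrow> real \<Rightarrow> 'a set" where
  "sector u h = {x \<in> ball 0 1. h * norm x < u \<bullet> x}"

lemma open_sector: "open (sector u h)"
proof -
  have "sector u h = ball 0 1 \<inter> {x. h * norm x < u \<bullet> x}" by (auto simp: sector_def)
  moreover have "open {x. h * norm x < u \<bullet> x}"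
    by (intro open_Collect_less continuous_intros)
  ultimately show ?thesis by auto
qed

text \<open>In \<open>complex \<times> real\<close> the volume is an iterated integral over the
  second factor, and the slices are planar discs of known area.\<close>

lemma emeasure_sector_axis:
  assumes h: "0 < h" "h \<le> 1"
  shows "emeasure lborel (sector (0 :: complex, 1 :: real) h) = ennreal (2 / 3 * pi * (1 - h))"
proof -
  let ?S = "sector (0 :: complex, 1 :: real) h"
  let ?g = "\<lambda>t::real. min (1 - t\<^sup>2) (t\<^sup>2 * (1 / h\<^sup>2 - 1))"
  have slice: "(\<lambda>z. (z, t)) -` ?S = (if t \<in> {0..1} then ball 0 (sqrt (?g t)) else {})" for t
  proof -
    have "(z, t) \<in> ?S \<longleftrightarrow> t \<in> {0..1} \<and> norm z < sqrt (?g t)" for z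
    proof -
      have "(z, t) \<in> ?S \<longleftrightarrow> sqrt ((norm z)\<^sup>2 + t\<^sup>2) < 1 \<and> h * sqrt ((norm z)\<^sup>2 + t\<^sup>2) < t"
        by (simp add: sector_def norm_prod_def)
      also have "\<dots> \<longleftrightarrow> t \<in> {0..1} \<and> norm z < sqrt (?g t)"
        by (rule sector_slice_iff[OF h norm_ge_zero])
      finally show ?thesis .
    qed
    then show ?thesis by auto
  qed
  have area: "emeasure lborel (ball (0::complex) (sqrt x)) = ennreal (pi * x)" if "x \<ge> 0" for x
    using that by (subst emeasure_ball) (simp_all add: unit_ball_vol_2)
  have meas: "?S \<in> sets (lborel \<Otimes>\<^sub>M lborel)"
    unfolding lborel_prod using borel_open[OF open_sector] by simp
  have "emeasure lborel ?S = emeasure (lborel \<Otimes>\<^sub>M lborel) ?S"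
    unfolding lborel_prod ..
  also have "\<dots> = (\<integral>\<^sup>+t. emeasure lborel ((\<lambda>z. (z, t)) -` ?S) \<partial>lborel)"
    by (rule lborel_pair.emeasure_pair_measure_alt2[OF meas])
  also have "\<dots> = (\<integral>\<^sup>+t. indicator {0..1} t * ennreal (pi * ?g t) \<partial>lborel)"
  proof (intro nn_integral_cong)
    fix t :: real
    show "emeasure lborel ((\<lambda>z::complex. (z, t)) -` ?S) = indicator {0..1} t * ennreal (pi * ?g t)"
    proof (cases "t \<in> {0..1}")
      case True
      then show ?thesis unfolding slice using area[OF sector_slice_nonneg[OF h True]]
        by (simp only: if_True indicator_simps mult_1)
    next
      case False
      then show ?thesis unfolding slice by (simp only: if_False indicator_simps emeasure_empty mult_zero_left simp_thms)
    qed
  qed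
  also have "\<dots> = ennreal (2 / 3 * pi * (1 - h))"
    by (rule nn_integral_sector_slices[OF h])
  finally show ?thesis .
qed

section \<open>Transfer of the sector volume to \<open>real ^ 3\<close>\<close>

definition to_prod :: "real ^ 3 \<Rightarrow> complex \<times> real" where
  "to_prod x = (Complex (x $ 1) (x $ 2), x $ 3)"

lemma to_prod_measurable: "to_prod \<in> borel_measurable borel"
proof -
  have eq: "to_prod = (\<lambda>x. (complex_of_real (x $ 1) + \<i> * complex_of_real (x $ 2), x $ 3))"
    by (auto simp: to_prod_def complex_eq_iff)
  show ?thesis
    unfolding eq by (intro borel_measurable_continuous_onI continuous_intros)
qed

lemma prod_Basis_vec3: "(\<Prod>b\<in>Basis. (w :: real ^ 3) \<bullet> b) = w $ 1 * w $ 2 * w $ 3"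
proof -
  have B: "(Basis :: (real ^ 3) set) = (\<lambda>i. axis i 1) ` {1, 2, 3}"
    unfolding Basis_vec_def UNIV_3[symmetric] by auto
  have "inj (\<lambda>i::3. axis i (1::real))"
    by (auto simp: inj_on_def axis_eq_axis)
  then have "(\<Prod>b\<in>Basis. w \<bullet> b) = (\<Prod>i\<in>{1, 2, 3}. w \<bullet> axis i 1)"
    unfolding B by (simp only: prod.reindex[OF inj_on_subset[OF _ subset_UNIV]] o_def)
  then show ?thesis
    by (simp add: cart_eq_inner_axis[symmetric] mult.assoc)
qed

lemma Basis_complex_real: "(Basis :: (complex \<times> real) set) = {(1, 0), (\<i>, 0), (0, 1)}"
  by (auto simp: Basis_prod_def Basis_complex_def)

text \<open>Lebesgue measure is determined by its values on boxes, and \<open>to_prod\<close> only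
  regroups coordinates, so the preimage of a box is the box with the same side lengths.\<close>

lemma distr_to_prod: "distr lborel borel to_prod = lborel"
proof (rule sym, rule lborel_eqI)
  fix l u :: "complex \<times> real"
  assume le: "\<And>b. b \<in> Basis \<Longrightarrow> l \<bullet> b \<le> u \<bullet> b"
  have inner: "x \<bullet> (1, 0) = Re (fst x)" "x \<bullet> (\<i>, 0) = Im (fst x)" "x \<bullet> (0, 1) = snd x"
    for x :: "complex \<times> real"
    by (simp_all add: inner_prod_def inner_complex_def)
  have le': "Re (fst l) \<le> Re (fst u)" "Im (fst l) \<le> Im (fst u)" "snd l \<le> snd u"
    using le unfolding Basis_complex_real inner[symmetric] by blast+
  define v :: "complex \<times> real \<Rightarrow> real ^ 3" where "v = (\<lambda>l. vector [Re (fst l), Im (fst l), snd l])"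
  have v: "v l $ 1 = Re (fst l)" "v l $ 2 = Im (fst l)" "v l $ 3 = snd l" for l
    by (simp_all add: v_def vector_3)
  have box: "x \<in> box l u \<longleftrightarrow> Re (fst l) < Re (fst x) \<and> Re (fst x) < Re (fst u) \<and>
      Im (fst l) < Im (fst x) \<and> Im (fst x) < Im (fst u) \<and> snd l < snd x \<and> snd x < snd u" for x
    unfolding mem_box Basis_complex_real ball_simps inner by (simp add: inner)
  have "to_prod -` box l u = box (v l) (v u)"
    unfolding set_eq_iff vimage_eq box mem_box_cart forall_3 v by (simp add: to_prod_def)
  then have "emeasure (distr lborel borel to_prod) (box l u) = emeasure lborel (box (v l) (v u))"
    by (subst emeasure_distr) (simp_all add: to_prod_measurable)
  also have "\<dots> = ennreal (\<Prod>b\<in>Basis. (v u - v l) \<bullet> b)"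
  proof (rule emeasure_lborel_box)
    fix b :: "real ^ 3" assume "b \<in> Basis"
    then obtain i where "b = axis i 1" by (auto simp: Basis_vec_def)
    then show "v l \<bullet> b \<le> v u \<bullet> b"
      using le' exhaust_3[of i] by (auto simp: cart_eq_inner_axis[symmetric] v)
  qed
  also have "(\<Prod>b\<in>Basis. (v u - v l) \<bullet> b) = (\<Prod>b\<in>Basis. (u - l) \<bullet> b)"
    unfolding prod_Basis_vec3 Basis_complex_real by (simp add: v inner mult.assoc)
  finally show "emeasure (distr lborel borel to_prod) (box l u) = ennreal (\<Prod>b\<in>Basis. (u - l) \<bullet> b)" .
qed simp

lemma lmeasurable_sector: "sector (u :: real ^ 3) h \<in> lmeasurable"
  by (rule lmeasurable_open[OF bounded_subset[OF bounded_ball[of 0 1]] open_sector])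
    (auto simp: sector_def)

text \<open>A rotation takes the third axis to \<open>u\<close>. The value is the fraction
  \<open>(1 - h) / 2\<close> of the volume \<open>4 / 3 * pi\<close> of the unit ball.\<close>

lemma measure_sector:
  fixes u :: "real ^ 3"
  assumes u: "norm u = 1" and h: "0 < h" "h \<le> 1"
  shows "measure lebesgue (sector u h) = 2 / 3 * pi * (1 - h)"
proof -
  let ?e = "axis 3 1 :: real ^ 3"
  have "to_prod -` sector (0, 1) h = sector ?e h"
  proof -
    have "norm (to_prod x) = norm x" for x
      by (simp add: to_prod_def norm_prod_def cmod_def norm_vec_def L2_set_def sum_3)
    moreover have "(0, 1) \<bullet> to_prod x = ?e \<bullet> x" for x
      by (simp add: to_prod_def inner_axis')
    ultimately show ?thesis
      by (simp add: sector_def set_eq_iff vimage_eq)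
  qed
  then have "emeasure lborel (sector ?e h) = emeasure (distr lborel borel to_prod) (sector (0, 1) h)"
    by (subst emeasure_distr) (auto simp: to_prod_measurable open_sector)
  also have "\<dots> = ennreal (2 / 3 * pi * (1 - h))"
    unfolding distr_to_prod by (rule emeasure_sector_axis[OF h])
  finally have "measure lborel (sector ?e h) = 2 / 3 * pi * (1 - h)"
    using h by (simp add: measure_def)
  then have e: "measure lebesgue (sector ?e h) = 2 / 3 * pi * (1 - h)"
    by (simp add: measure_completion open_sector)
  obtain f where f: "orthogonal_transformation f" "f ?e = u"
    using orthogonal_transformation_exists_1[of ?e u] u by auto
  have iff: "f y \<in> sector u h \<longleftrightarrow> y \<in> sector ?e h" for y
  proof -
    have "norm (f y) = norm y" "f ?e \<bullet> f y = ?e \<bullet> y"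
      using f(1) orthogonal_transformation_norm[OF f(1)] unfolding orthogonal_transformation_def by blast+
    then show ?thesis unfolding sector_def f(2) by simp
  qed
  have "sector u h = f ` sector ?e h"
  proof (intro set_eqI iffI)
    fix x assume x: "x \<in> sector u h"
    obtain y where y: "x = f y"
      using orthogonal_transformation_surj[OF f(1)] by (auto simp: surj_def)
    then have "y \<in> sector ?e h" using x iff by simp
    then show "x \<in> f ` sector ?e h" using y by blast
  next
    fix x assume "x \<in> f ` sector ?e h"
    then show "x \<in> sector u h" using iff by blast
  qed
  moreover have "sector ?e h \<in> lmeasurable"
    by (rule lmeasurable_sector)
  ultimately show ?thesis using e measure_orthogonal_image[OF f(1)] by simp
qed

section \<open>Disjoint caps\<close>

text \<open>This is the bounding circle of the cap, drawn on the sphere of radius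
  \<open>1 / 2\<close> so that its points can be moved a little without leaving the unit
  ball.\<close>

lemma infinite_cap_circle:
  fixes u :: "real ^ 3"
  assumes u: "norm u = 1" and h: "0 < h" "h < 1"
  shows "infinite {y. norm y = 1 / 2 \<and> u \<bullet> y = h / 2}"
proof -
  obtain f where f: "orthogonal_transformation f" "f (axis 3 1 :: real ^ 3) = u"
    using orthogonal_transformation_exists_1[of "axis 3 1 :: real ^ 3" u] u by auto
  \<comment> \<open>\<open>b\<close> is the squared radius of the circle, and \<open>p\<close> below
    parametrises a quarter of it by the first coordinate.\<close>
  define b where "b = (1 - h\<^sup>2) / 4"
  have "h\<^sup>2 < 1" using h by (simp add: abs_square_less_1)
  then have b: "b > 0" by (simp add: b_def)
  define p :: "real \<Rightarrow> real ^ 3" where "p = (\<lambda>s. vector [s, sqrt (b - s\<^sup>2), h / 2])"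
  have p: "p s $ 1 = s" "p s $ 2 = sqrt (b - s\<^sup>2)" "p s $ 3 = h / 2" for s
    by (simp_all add: p_def vector_3)
  have on_circle: "f (p s) \<in> {y. norm y = 1 / 2 \<and> u \<bullet> y = h / 2}" if s: "s \<in> {0..sqrt b}" for s
  proof -
    have "s\<^sup>2 \<le> (sqrt b)\<^sup>2" using s by (intro power_mono) auto
    then have "s\<^sup>2 \<le> b" using b by simp
    then have "(norm (p s))\<^sup>2 = (1 / 2)\<^sup>2"
      by (simp add: power2_norm_eq_inner inner_vec_def sum_3 p flip: power2_eq_square)
        (simp add: b_def field_simps power2_eq_square)
    then have "norm (p s) = 1 / 2" by (subst (asm) power2_eq_iff_nonneg) auto
    moreover have "norm (f (p s)) = norm (p s)" "f (axis 3 1) \<bullet> f (p s) = axis 3 1 \<bullet> p s"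
      using f(1) orthogonal_transformation_norm[OF f(1)] unfolding orthogonal_transformation_def by blast+
    ultimately show ?thesis by (simp add: f(2) inner_axis' p)
  qed
  have "inj f" using f(1) by (rule orthogonal_transformation_inj)
  have "inj_on (\<lambda>s. f (p s)) {0..sqrt b}"
  proof (rule inj_onI)
    fix s t assume "f (p s) = f (p t)"
    then have "p s $ 1 = p t $ 1" using \<open>inj f\<close> by (simp add: inj_eq)
    then show "s = t" by (simp add: p)
  qed
  moreover have "infinite {0..sqrt b}" using b by (simp add: infinite_Icc)
  ultimately have "infinite ((\<lambda>s. f (p s)) ` {0..sqrt b})"
    by (simp add: finite_image_iff)
  moreover have "(\<lambda>s. f (p s)) ` {0..sqrt b} \<subseteq> {y. norm y = 1 / 2 \<and> u \<bullet> y = h / 2}"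
    using on_circle by blast
  ultimately show ?thesis using finite_subset by blast
qed

text \<open>If the closed caps covered everything, each point of the circle bounding cap
  \<open>k\<close> would lie in another closed cap. Two of these points would share one, and the
  midpoint of their chord would lie in two open sectors.\<close>

lemma disjoint_sectors_not_cover:
  fixes u :: "'n::finite \<Rightarrow> real ^ 3"
  assumes u: "\<And>i. norm (u i) = 1" and h: "\<And>i. 0 < h i" and k: "h k < 1"
    and disj: "\<And>i j. i \<noteq> j \<Longrightarrow> sector (u i) (h i) \<inter> sector (u j) (h j) = {}"
  shows "\<exists>x\<in>ball 0 1. \<forall>i. u i \<bullet> x < h i * norm x"
proof (rule ccontr)
  assume "\<not> ?thesis"
  then have cover: "\<exists>i. h i * norm x \<le> u i \<bullet> x" if "norm x < 1" for x
    using that by (force simp: not_less)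
  define Y where "Y = {y. norm y = 1 / 2 \<and> u k \<bullet> y = h k / 2}"
  define C where "C j = {x. h j * norm x \<le> u j \<bullet> x}" for j
  have closed: "closed (\<Union>j\<in>UNIV - {k}. C j)"
    unfolding C_def by (intro closed_UN ballI closed_Collect_le continuous_intros) auto
  have other: "\<exists>j. j \<noteq> k \<and> y \<in> C j" if y: "y \<in> Y" for y
  proof -
    \<comment> \<open>Moving \<open>y\<close> by \<open>e\<close> against \<open>u k\<close> leaves
      the closed cap \<open>k\<close>: the inner product with \<open>u k\<close> drops by
      \<open>e\<close>, but \<open>h k\<close> times the norm drops by at most
      \<open>h k * e\<close>, and \<open>h k < 1\<close>.\<close>
    have out: "y - e *\<^sub>R u k \<in> (\<Union>j\<in>UNIV - {k}. C j)" if e: "0 < e" "e < 1 / 2" for e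
    proof -
      have "norm (y - e *\<^sub>R u k) \<le> norm y + norm (e *\<^sub>R u k)" by (rule norm_triangle_ineq4)
      then have "norm (y - e *\<^sub>R u k) < 1" using y e u[of k] by (simp add: Y_def)
      from cover[OF this] obtain j where j: "h j * norm (y - e *\<^sub>R u k) \<le> u j \<bullet> (y - e *\<^sub>R u k)" by blast
      have "j \<noteq> k"
      proof
        assume "j = k"
        have "u k \<bullet> u k = 1" using u[of k] by (simp add: norm_eq_1)
        then have "h k * norm (y - e *\<^sub>R u k) \<le> h k / 2 - e"
          using j y \<open>j = k\<close> by (simp add: inner_diff_right Y_def)
        moreover have "norm y - norm (e *\<^sub>R u k) \<le> norm (y - e *\<^sub>R u k)" by (rule norm_triangle_ineq2)
        then have "h k * (1 / 2 - e) \<le> h k * norm (y - e *\<^sub>R u k)"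
          using h[of k] y e u[of k] by (intro mult_left_mono) (auto simp: Y_def)
        moreover have "h k * e < 1 * e" using k e by (intro mult_strict_right_mono) auto
        ultimately show False by (simp add: right_diff_distrib)
      qed
      with j show ?thesis by (auto simp: C_def)
    qed
    \<comment> \<open>As \<open>e\<close> tends to 0, \<open>y\<close> itself stays in the union of
      the other closed caps, which is closed because it is finite.\<close>
    have "((\<lambda>e. y - e *\<^sub>R u k) \<longlongrightarrow> y - 0 *\<^sub>R u k) (at_right 0)"
      by (intro tendsto_intros)
    moreover have "\<forall>\<^sub>F e in at_right (0::real). y - e *\<^sub>R u k \<in> (\<Union>j\<in>UNIV - {k}. C j)"
      using out by (intro eventually_at_rightI[of 0 "1 / 2"]) auto
    ultimately have "y - 0 *\<^sub>R u k \<in> (\<Union>j\<in>UNIV - {k}. C j)"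
      using closed by (intro Lim_in_closed_set[of _ _ "at_right (0::real)"]) auto
    then show ?thesis by auto
  qed
  then obtain g where g: "\<And>y. y \<in> Y \<Longrightarrow> g y \<noteq> k \<and> y \<in> C (g y)" by metis
  have "infinite Y" unfolding Y_def by (rule infinite_cap_circle[OF u h k])
  then obtain y0 where y0: "y0 \<in> Y" "infinite {y \<in> Y. g y = g y0}"
    using pigeonhole_infinite[of Y g] by auto
  then obtain z where z: "z \<in> Y" "g z = g y0" "z \<noteq> y0"
  proof -
    have "infinite ({y \<in> Y. g y = g y0} - {y0})" using y0(2) by simp
    then have "{y \<in> Y. g y = g y0} - {y0} \<noteq> {}" by (metis finite.emptyI)
    then show ?thesis using that by blast
  qed
  let ?j = "g y0"
  \<comment> \<open>The norm of the chord midpoint is below \<open>1 / 2\<close> by the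
    parallelogram law, while its inner products with \<open>u k\<close> and \<open>u ?j\<close> are
    averages. Hence the weak inequalities at the end points become strict.\<close>
  let ?m = "(1 / 2) *\<^sub>R (y0 + z)"
  have ny: "norm y0 = 1 / 2" "norm z = 1 / 2" using y0 z by (auto simp: Y_def)
  have "(norm ?m)\<^sup>2 + (norm ((1 / 2) *\<^sub>R (y0 - z)))\<^sup>2 = ((norm y0)\<^sup>2 + (norm z)\<^sup>2) / 2"
    by (simp add: power2_norm_eq_inner inner_add_left inner_add_right inner_diff_left inner_diff_right
        inner_commute field_simps)
  moreover have "0 < (norm ((1 / 2) *\<^sub>R (y0 - z)))\<^sup>2" using z(3) by simp
  ultimately have "(norm ?m)\<^sup>2 < (1 / 2)\<^sup>2" unfolding ny by (simp add: power2_eq_square)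
  then have m: "norm ?m < 1 / 2" by (rule power2_less_imp_less) simp
  have "h k * norm ?m < h k * (1 / 2)" using m h[of k] by (rule mult_strict_left_mono)
  also have "\<dots> = u k \<bullet> ?m" using y0(1) z(1) by (simp add: Y_def inner_add_right)
  finally have 1: "?m \<in> sector (u k) (h k)" using m by (simp add: sector_def)
  have "h ?j * norm ?m < h ?j * (1 / 2)" using m h[of ?j] by (rule mult_strict_left_mono)
  also have "\<dots> \<le> u ?j \<bullet> ?m"
    using g[OF y0(1)] g[OF z(1)] z(2) ny by (simp add: C_def inner_add_right)
  finally have 2: "?m \<in> sector (u ?j) (h ?j)" using m by (simp add: sector_def)
  show False using disj[of k ?j] g[OF y0(1)] 1 2 by auto
qed

text \<open>If the fractions added up to 1 or more, the disjoint sectors would exhaust the volume of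
  the ball and leave a null set, yet an open part of the ball is never covered.\<close>

lemma sum_disjoint_caps_less_1:
  fixes u :: "'n::finite \<Rightarrow> real ^ 3"
  assumes u: "\<And>i. norm (u i) = 1" and h: "\<And>i. 0 < h i" "\<And>i. h i \<le> 1"
    and disj: "\<And>i j. i \<noteq> j \<Longrightarrow> sector (u i) (h i) \<inter> sector (u j) (h j) = {}"
  shows "(\<Sum>i\<in>UNIV. (1 - h i) / 2) < 1"
proof (rule ccontr)
  assume "\<not> ?thesis"
  then have ge: "1 \<le> (\<Sum>i\<in>UNIV. (1 - h i) / 2)" by simp
  let ?U = "\<Union>i. sector (u i) (h i)"
  have k: "\<exists>k. h k < 1"
  proof (rule ccontr)
    assume "\<nexists>k. h k < 1"
    then have "h i = 1" for i using h(2)[of i] by (meson antisym_conv2)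
    then show False using ge by simp
  qed
  then obtain k where k: "h k < 1" by blast
  have lm: "?U \<in> lmeasurable" by (intro fmeasurable.finite_UN) (auto simp: lmeasurable_sector)
  have "measure lebesgue ?U = (\<Sum>i\<in>UNIV. measure lebesgue (sector (u i) (h i)))"
  proof (rule measure_finite_Union)
    show "range (\<lambda>i. sector (u i) (h i)) \<subseteq> sets lebesgue"
      using fmeasurableD[OF lmeasurable_sector] by blast
    show "emeasure lebesgue (sector (u i) (h i)) \<noteq> \<infinity>" for i
      using fmeasurableD2[OF lmeasurable_sector] by simp
    show "disjoint_family_on (\<lambda>i. sector (u i) (h i)) UNIV"
      using disj by (simp add: disjoint_family_on_def)
  qed simp
  also have "\<dots> = (\<Sum>i\<in>UNIV. 4 / 3 * pi * ((1 - h i) / 2))"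
    by (intro sum.cong refl, subst measure_sector) (use u h in auto)
  also have "\<dots> = 4 / 3 * pi * (\<Sum>i\<in>UNIV. (1 - h i) / 2)"
    by (rule sum_distrib_left[symmetric])
  finally have "4 / 3 * pi * 1 \<le> measure lebesgue ?U"
    using mult_left_mono[OF ge, of "4 / 3 * pi"] by simp
  moreover have "measure lebesgue (ball 0 1 :: (real ^ 3) set) = 4 / 3 * pi"
    using sphere_volume[of 1 0] by (simp add: measure_completion)
  moreover have "?U \<subseteq> ball 0 1" by (auto simp: sector_def)
  then have "measure lebesgue (ball 0 1 - ?U) = measure lebesgue (ball 0 1 :: (real ^ 3) set) - measure lebesgue ?U"
    using lm by (intro measurable_measure_Diff) (auto intro: fmeasurableD)
  ultimately have "measure lebesgue (ball 0 1 - ?U) \<le> 0" by simp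
  moreover have "ball 0 1 - ?U \<in> lmeasurable"
    using lm by (intro fmeasurable.Diff) auto
  ultimately have "negligible (ball 0 1 - ?U)"
    by (simp add: negligible_iff_measure measure_le_0_iff)
  \<comment> \<open>The complement of the open sectors need not be open. \<open>?W\<close> is the
    complement of the closed sectors; it is open, so being null forces it to be empty.\<close>
  let ?W = "{x. norm x < 1} \<inter> (\<Inter>i. {x. u i \<bullet> x < h i * norm x})"
  have "open ?W"
    by (intro open_Int open_INT open_Collect_less continuous_intros ballI) auto
  moreover have "?W \<subseteq> ball 0 1 - ?U"
  proof
    fix x assume x: "x \<in> ?W"
    then have "\<not> h i * norm x < u i \<bullet> x" for i by (simp add: not_less less_imp_le)
    then show "x \<in> ball 0 1 - ?U" using x by (simp add: sector_def)
  qed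
  then have "negligible ?W" using \<open>negligible (ball 0 1 - ?U)\<close> negligible_subset by blast
  ultimately have "?W = {}" using open_not_negligible by blast
  moreover obtain x where "x \<in> ball 0 1" "\<forall>i. u i \<bullet> x < h i * norm x"
    using disjoint_sectors_not_cover[of u h, OF u h(1) k disj] by blast
  ultimately show False by auto
qed

text \<open>Families of caps indexed by a finite type are points of a finite-dimensional space. The
  admissible ones form a compact set, on which the continuous covered fraction attains a maximum,
  and this is less than 1. The bound \<open>h0\<close> keeps the heights positive in the
  limit.\<close>

lemma disjoint_caps_gap_type:
  fixes h0 :: real
  assumes h0: "0 < h0"
  obtains \<delta> where "\<delta> > 0" "\<And>(u :: 'n::finite \<Rightarrow> real ^ 3) h.
    \<lbrakk>\<And>i. norm (u i) = 1; \<And>i. h0 \<le> h i; \<And>i. h i \<le> 1;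
     \<And>i j. i \<noteq> j \<Longrightarrow> sector (u i) (h i) \<inter> sector (u j) (h j) = {}\<rbrakk>
    \<Longrightarrow> (\<Sum>i\<in>UNIV. (1 - h i) / 2) \<le> 1 - \<delta>"
proof -
  \<comment> \<open>Disjointness is expressed point by point: no \<open>x\<close> of the unit ball
    satisfies both strict inequalities. This makes \<open>S\<close> an intersection of closed
    sets.\<close>
  define S :: "(((real ^ 3) \<times> real) ^ 'n) set" where "S =
    (\<Inter>i. {f. norm (fst (f $ i)) = 1} \<inter> {f. h0 \<le> snd (f $ i)} \<inter> {f. snd (f $ i) \<le> 1}) \<inter>
    (\<Inter>i. \<Inter>j\<in>-{i}. \<Inter>x\<in>{x. norm x < 1}. {f. fst (f $ i) \<bullet> x \<le> snd (f $ i) * norm x} \<union>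
       {f. fst (f $ j) \<bullet> x \<le> snd (f $ j) * norm x})"
  define F where "F f = (\<Sum>i\<in>UNIV. (1 - snd (f $ i)) / 2)" for f :: "((real ^ 3) \<times> real) ^ 'n"
  have mem: "(\<chi> i. (u i, h i)) \<in> S"
    if "\<And>i. norm (u i) = 1" "\<And>i. h0 \<le> h i" "\<And>i. h i \<le> 1"
      "\<And>i j. i \<noteq> j \<Longrightarrow> sector (u i) (h i) \<inter> sector (u j) (h j) = {}" for u h
  proof -
    have "u i \<bullet> x \<le> h i * norm x \<or> u j \<bullet> x \<le> h j * norm x" if "i \<noteq> j" "norm x < 1" for i j x
      using that(2) \<open>i \<noteq> j \<Longrightarrow> sector (u i) (h i) \<inter> sector (u j) (h j) = {}\<close>[OF that(1)]
      by (force simp: sector_def)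
    then show ?thesis using that by (simp add: S_def)
  qed
  have F_less: "F f < 1" if f: "f \<in> S" for f
  proof -
    have disj: "sector (fst (f $ i)) (snd (f $ i)) \<inter> sector (fst (f $ j)) (snd (f $ j)) = {}" if "i \<noteq> j" for i j
      using f that by (force simp: S_def sector_def)
    show ?thesis unfolding F_def
      by (rule sum_disjoint_caps_less_1[where u = "\<lambda>i. fst (f $ i)"])
        (use f h0 disj in \<open>auto simp: S_def intro: less_le_trans\<close>)
  qed
  have "closed S" unfolding S_def
    by (intro closed_Int closed_INT closed_Un ballI closed_Collect_le closed_Collect_eq continuous_intros)
  moreover have "bounded S"
  proof (rule boundedI)
    fix f assume f: "f \<in> S"
    have "norm (f $ i) \<le> 2" for i
    proof -
      have "norm (f $ i) \<le> norm (fst (f $ i)) + norm (snd (f $ i))"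
        using norm_Pair_le[of "fst (f $ i)" "snd (f $ i)"] by simp
      moreover have "norm (fst (f $ i)) = 1" "h0 \<le> snd (f $ i)" "snd (f $ i) \<le> 1"
        using f by (auto simp: S_def)
      ultimately show ?thesis using h0 by simp
    qed
    moreover have "norm f \<le> (\<Sum>i\<in>UNIV. norm (f $ i))"
      unfolding norm_vec_def by (rule L2_set_le_sum) auto
    ultimately show "norm f \<le> (\<Sum>i\<in>(UNIV :: 'n set). 2)"
      by (meson order_trans sum_mono)
  qed
  ultimately have "compact S" by (simp add: compact_eq_bounded_closed)
  show ?thesis
  proof (cases "S = {}")
    case True
    show ?thesis
    proof (rule that[of 1])
      fix u :: "'n \<Rightarrow> real ^ 3" and h
      assume "\<And>i. norm (u i) = 1" "\<And>i. h0 \<le> h i" "\<And>i. h i \<le> 1"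
        "\<And>i j. i \<noteq> j \<Longrightarrow> sector (u i) (h i) \<inter> sector (u j) (h j) = {}"
      then have "(\<chi> i. (u i, h i)) \<in> S" by (rule mem)
      with True show "(\<Sum>i\<in>UNIV. (1 - h i) / 2) \<le> 1 - 1" by blast
    qed simp
  next
    case False
    moreover have "continuous_on S F" unfolding F_def by (intro continuous_intros) auto
    ultimately obtain g where g: "g \<in> S" "\<And>f. f \<in> S \<Longrightarrow> F f \<le> F g"
      using continuous_attains_sup[OF \<open>compact S\<close>] by blast
    show ?thesis
    proof (rule that[of "1 - F g"])
      show "0 < 1 - F g" using F_less[OF g(1)] by simp
      fix u :: "'n \<Rightarrow> real ^ 3" and h
      assume "\<And>i. norm (u i) = 1" "\<And>i. h0 \<le> h i" "\<And>i. h i \<le> 1"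
        "\<And>i j. i \<noteq> j \<Longrightarrow> sector (u i) (h i) \<inter> sector (u j) (h j) = {}"
      from g(2)[OF mem[OF this]] show "(\<Sum>i\<in>UNIV. (1 - h i) / 2) \<le> 1 - (1 - F g)"
        by (simp add: F_def)
    qed
  qed
qed

text \<open>By the Cauchy-Schwarz inequality. Caps of height 1 serve as padding below.\<close>

lemma sector_1_eq_empty:
  assumes "norm u = 1"
  shows "sector u 1 = {}"
proof -
  have "u \<bullet> x \<le> 1 * norm x" for x
    using norm_cauchy_schwarz[of u x] assms by simp
  then show ?thesis by (auto simp: sector_def not_less)
qed

text \<open>A family of at most \<open>CARD('n)\<close> caps is embedded in the type
  \<open>'n\<close> and completed by caps of height 1, which are empty and add nothing to the sum.
  So one \<open>\<delta>\<close> serves for all these families.\<close>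

lemma disjoint_caps_gap:
  fixes h0 :: real
  assumes h0: "0 < h0" "h0 \<le> 1"
  obtains \<delta> where "\<delta> > 0" "\<And>(K :: 'i set) (u :: 'i \<Rightarrow> real ^ 3) h.
    \<lbrakk>finite K; card K \<le> CARD('n::finite); \<And>i. i \<in> K \<Longrightarrow> norm (u i) = 1; \<And>i. i \<in> K \<Longrightarrow> h0 \<le> h i;
     \<And>i. i \<in> K \<Longrightarrow> h i \<le> 1;
     \<And>i j. \<lbrakk>i \<in> K; j \<in> K; i \<noteq> j\<rbrakk> \<Longrightarrow> sector (u i) (h i) \<inter> sector (u j) (h j) = {}\<rbrakk>
    \<Longrightarrow> (\<Sum>i\<in>K. (1 - h i) / 2) \<le> 1 - \<delta>"
proof (rule disjoint_caps_gap_type[OF h0(1), where 'n = 'n])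
  fix \<delta> :: real
  assume \<delta>: "\<delta> > 0" and gap: "\<And>(u :: 'n \<Rightarrow> real ^ 3) h.
    \<lbrakk>\<And>i. norm (u i) = 1; \<And>i. h0 \<le> h i; \<And>i. h i \<le> 1;
     \<And>i j. i \<noteq> j \<Longrightarrow> sector (u i) (h i) \<inter> sector (u j) (h j) = {}\<rbrakk>
    \<Longrightarrow> (\<Sum>i\<in>UNIV. (1 - h i) / 2) \<le> 1 - \<delta>"
  show ?thesis
  proof (rule that[OF \<delta>])
    fix K :: "'i set" and u :: "'i \<Rightarrow> real ^ 3" and h
    assume K: "finite K" "card K \<le> CARD('n)"
      and u: "\<And>i. i \<in> K \<Longrightarrow> norm (u i) = 1" and h: "\<And>i. i \<in> K \<Longrightarrow> h0 \<le> h i" "\<And>i. i \<in> K \<Longrightarrow> h i \<le> 1"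
      and disj: "\<And>i j. \<lbrakk>i \<in> K; j \<in> K; i \<noteq> j\<rbrakk> \<Longrightarrow> sector (u i) (h i) \<inter> sector (u j) (h j) = {}"
    obtain g :: "'i \<Rightarrow> 'n" where g: "inj_on g K"
      using card_le_inj[OF K(1) finite_class.finite_UNIV K(2)] by auto
    define u' where "u' n = (if n \<in> g ` K then u (the_inv_into K g n) else axis 1 1)" for n
    define h' where "h' n = (if n \<in> g ` K then h (the_inv_into K g n) else 1)" for n
    have eq: "u' (g i) = u i" "h' (g i) = h i" if "i \<in> K" for i
      using that g by (simp_all add: u'_def h'_def the_inv_into_f_f)
    have out: "u' n = axis 1 1" "h' n = 1" if "n \<notin> g ` K" for n
      using that by (simp_all add: u'_def h'_def)
    have "(\<Sum>i\<in>K. (1 - h i) / 2) = (\<Sum>n\<in>g ` K. (1 - h' n) / 2)"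
      using g by (simp add: sum.reindex eq)
    also have "\<dots> = (\<Sum>n\<in>UNIV. (1 - h' n) / 2)"
      by (rule sum.mono_neutral_left) (auto simp: out)
    also have "\<dots> \<le> 1 - \<delta>"
    proof (rule gap[of u'])
      show norm: "norm (u' n) = 1" for n
        by (cases "n \<in> g ` K") (auto simp: eq u out)
      show "h0 \<le> h' n" for n
        by (cases "n \<in> g ` K") (auto simp: eq h out h0)
      show "h' n \<le> 1" for n
        by (cases "n \<in> g ` K") (auto simp: eq h out)
      show "sector (u' n) (h' n) \<inter> sector (u' m) (h' m) = {}" if nm: "n \<noteq> m" for n m
      proof (cases "n \<in> g ` K \<and> m \<in> g ` K")
        case True
        then obtain i j where "n = g i" "m = g j" "i \<in> K" "j \<in> K" by blast
        then show ?thesis using disj[of i j] nm by (auto simp: eq)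
      next
        case False
        then have "sector (u' n) (h' n) = {} \<or> sector (u' m) (h' m) = {}"
          using sector_1_eq_empty norm out(2) by metis
        then show ?thesis by blast
      qed
    qed
    finally show "(\<Sum>i\<in>K. (1 - h i) / 2) \<le> 1 - \<delta>" .
  qed
qed

section \<open>Caps cut out by tangent balls\<close>

text \<open>The law of cosines in the triangle with sides \<open>r + s\<close>,
  \<open>sqrt 3 * r\<close> and \<open>s\<close>: when at most 1, this is the cosine of the angular
  radius of the cap.\<close>

definition cap_height :: "real \<Rightarrow> real \<Rightarrow> real" where
  "cap_height r s = (2 * r + s) / (sqrt 3 * (r + s))"

text \<open>This explains the factor \<open>sqrt 3\<close>. With spheres of radius
  \<open>t * r\<close> and \<open>t * s\<close> instead, the heights would add up to
  \<open>(t\<^sup>2 + 3) / (2 * t)\<close>, again independent of \<open>r\<close> and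
  \<open>s\<close>, and among positive \<open>t\<close> the minimum is at
  \<open>sqrt 3\<close>.\<close>

lemma cap_height_add:
  assumes "r > 0" "s > 0"
  shows "cap_height r s + cap_height s r = sqrt 3"
proof -
  have "cap_height r s + cap_height s r = 3 * (r + s) / (sqrt 3 * (r + s))"
    by (simp add: cap_height_def add_divide_distrib[symmetric] add.commute[of s r])
  also have "\<dots> = 3 / sqrt 3"
    using assms by (intro mult_divide_mult_cancel_right) simp
  also have "\<dots> = sqrt 3" by (simp add: real_div_sqrt)
  finally show ?thesis .
qed

text \<open>A lower bound independent of the radii, as the compactness argument requires.\<close>

lemma cap_height_ge:
  assumes "r > 0" "s > 0"
  shows "1 / sqrt 3 \<le> cap_height r s"
proof -
  have "1 / sqrt 3 = (r + s) / (sqrt 3 * (r + s))" using assms by simp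
  also have "\<dots> \<le> cap_height r s"
    unfolding cap_height_def using assms by (intro divide_right_mono) auto
  finally show ?thesis .
qed

text \<open>Only neighbours that are not too small reach the larger sphere; this will bound their
  number.\<close>

lemma cap_height_less_1D:
  assumes "r > 0" "s > 0" "cap_height r s < 1"
  shows "r / 3 < s"
proof -
  have "2 * r + s < sqrt 3 * (r + s)"
    using assms by (simp add: cap_height_def pos_divide_less_eq)
  moreover have "sqrt 3 \<le> 7 / 4" by (rule real_le_lsqrt) (auto simp: power2_eq_square)
  then have "sqrt 3 * (r + s) \<le> 7 / 4 * (r + s)" using assms by (intro mult_right_mono) auto
  ultimately show ?thesis by (simp add: algebra_simps)
qed

text \<open>The radial projection of the sector to the sphere of radius \<open>sqrt 3 * r\<close>
  about \<open>c\<close> lies inside the neighbouring ball. Two overlapping sectors would thus give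
  a common point of two disjoint balls.\<close>

lemma sector_shadow:
  fixes c a :: "real ^ 3"
  assumes r: "r > 0" and s: "s > 0" and d: "dist c a = r + s"
    and x: "x \<in> sector ((1 / (r + s)) *\<^sub>R (a - c)) (cap_height r s)"
  shows "c + (sqrt 3 * r / norm x) *\<^sub>R x \<in> ball a s"
proof -
  let ?u = "(1 / (r + s)) *\<^sub>R (a - c)"
  have rs: "r + s > 0" using r s by simp
  have x0: "x \<noteq> 0" using x by (auto simp: sector_def)
  define t where "t = (1 / norm x) *\<^sub>R x"
  have t: "norm t = 1" using x0 by (simp add: t_def)
  have "cap_height r s * norm x < ?u \<bullet> x" using x by (simp add: sector_def)
  then have "cap_height r s * norm x / norm x < ?u \<bullet> x / norm x"
    using x0 by (intro divide_strict_right_mono) auto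
  then have "cap_height r s < ?u \<bullet> t" using x0 by (simp add: t_def mult.commute)
  then have "(r + s) * cap_height r s < (r + s) * (?u \<bullet> t)" using rs by (rule mult_strict_left_mono)
  then have "(2 * r + s) / sqrt 3 < (a - c) \<bullet> t" using rs by (simp add: cap_height_def)
  then have *: "2 * r + s < sqrt 3 * ((a - c) \<bullet> t)"
    by (simp add: pos_divide_less_eq mult.commute)
  have dd: "(a - c) \<bullet> (a - c) = (r + s)\<^sup>2"
    using d by (simp add: dist_norm power2_norm_eq_inner[symmetric] norm_minus_commute)
  have "a - (c + (sqrt 3 * r) *\<^sub>R t) = (a - c) - (sqrt 3 * r) *\<^sub>R t" by simp
  moreover have "(norm (w - v))\<^sup>2 = w \<bullet> w - 2 * (w \<bullet> v) + (norm v)\<^sup>2" for w v :: "real ^ 3"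
    by (simp add: power2_norm_eq_inner inner_diff_left inner_diff_right inner_commute)
  ultimately have "(norm (a - (c + (sqrt 3 * r) *\<^sub>R t)))\<^sup>2 =
      (a - c) \<bullet> (a - c) - 2 * ((a - c) \<bullet> ((sqrt 3 * r) *\<^sub>R t)) + (norm ((sqrt 3 * r) *\<^sub>R t))\<^sup>2"
    by (simp only:)
  also have "(norm ((sqrt 3 * r) *\<^sub>R t))\<^sup>2 = 3 * r\<^sup>2"
    using t r by (simp add: power_mult_distrib)
  also have "(a - c) \<bullet> ((sqrt 3 * r) *\<^sub>R t) = r * (sqrt 3 * ((a - c) \<bullet> t))" by simp
  also have "(a - c) \<bullet> (a - c) - 2 * (r * (sqrt 3 * ((a - c) \<bullet> t))) + 3 * r\<^sup>2 =
      (r + s)\<^sup>2 - 2 * r * (sqrt 3 * ((a - c) \<bullet> t)) + 3 * r\<^sup>2"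
    by (simp only: dd mult.assoc)
  also have "\<dots> < (r + s)\<^sup>2 - 2 * r * (2 * r + s) + 3 * r\<^sup>2"
    using mult_strict_left_mono[OF *, of "2 * r"] r by simp
  also have "\<dots> = s\<^sup>2" by (simp add: power2_eq_square algebra_simps)
  finally have "(norm (a - (c + (sqrt 3 * r) *\<^sub>R t)))\<^sup>2 < s\<^sup>2" .
  then have "norm (a - (c + (sqrt 3 * r) *\<^sub>R t)) < s"
    by (rule power2_less_imp_less) (use s in simp)
  then show ?thesis by (simp add: dist_norm t_def)
qed

text \<open>Each neighbour contains a ball of radius \<open>r / 3\<close> touching the central ball.
  These are disjoint and lie within \<open>5 / 3 * r\<close> of \<open>c\<close>, so comparing
  volumes bounds their number by \<open>5 ^ 3\<close>.\<close>

lemma card_large_neighbours_le: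
  fixes c :: "real ^ 3" and a :: "'i \<Rightarrow> real ^ 3"
  assumes r: "r > 0" and fin: "finite K"
    and s: "\<And>i. i \<in> K \<Longrightarrow> r / 3 < s i"
    and d: "\<And>i. i \<in> K \<Longrightarrow> dist c (a i) = r + s i"
    and disj: "\<And>i j. \<lbrakk>i \<in> K; j \<in> K; i \<noteq> j\<rbrakk> \<Longrightarrow> s i + s j \<le> dist (a i) (a j)"
  shows "card K \<le> 125"
proof -
  \<comment> \<open>The centre of the shrunken ball lies on the ray from \<open>c\<close> to
    \<open>a i\<close>, at distance \<open>r + r / 3\<close> from \<open>c\<close>.\<close>
  define p where "p i = c + ((r + r / 3) / (r + s i)) *\<^sub>R (a i - c)" for i
  have rs: "r + s i > 0" if "i \<in> K" for i using s[OF that] r by simp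
  have frac: "\<bar>x / (r + s i)\<bar> * (r + s i) = x" if "x \<ge> 0" "i \<in> K" for x i
    using rs[OF that(2)] that(1) by simp
  have pa: "ball (p i) (r / 3) \<subseteq> ball (a i) (s i)" if i: "i \<in> K" for i
  proof -
    have "a i - p i = (1 - (r + r / 3) / (r + s i)) *\<^sub>R (a i - c)"
      by (simp add: p_def scaleR_diff_left)
    also have "1 - (r + r / 3) / (r + s i) = (s i - r / 3) / (r + s i)"
      using rs[OF i] by (simp add: field_simps)
    finally have "dist (p i) (a i) = \<bar>(s i - r / 3) / (r + s i)\<bar> * dist c (a i)"
      by (simp add: dist_norm norm_minus_commute)
    also have "\<dots> = s i - r / 3"
      unfolding d[OF i] using s[OF i] i by (intro frac) auto
    finally show ?thesis
      unfolding ball_subset_ball_iff by simp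
  qed
  have pc: "ball (p i) (r / 3) \<subseteq> ball c (5 / 3 * r)" if i: "i \<in> K" for i
  proof -
    have "dist (p i) c = \<bar>(r + r / 3) / (r + s i)\<bar> * dist c (a i)"
      by (simp add: p_def dist_norm norm_minus_commute)
    also have "\<dots> = r + r / 3" unfolding d[OF i] using r i by (intro frac) auto
    finally show ?thesis unfolding ball_subset_ball_iff using r by simp
  qed
  have vol: "measure lebesgue (ball x t) = 4 / 3 * t ^ 3 * pi" if "t \<ge> 0" for x :: "real ^ 3" and t
    using sphere_volume[OF that, of x] by (simp add: measure_completion)
  have "real (card K) * (4 / 3 * (r / 3) ^ 3 * pi) = (\<Sum>i\<in>K. measure lebesgue (ball (p i) (r / 3)))"
    using r by (subst sum.cong[OF refl vol]) simp_all
  also have "\<dots> = measure lebesgue (\<Union>i\<in>K. ball (p i) (r / 3))"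
  proof (rule measure_finite_Union[symmetric, OF fin])
    show "(\<lambda>i. ball (p i) (r / 3)) ` K \<subseteq> sets lebesgue" by auto
    show "emeasure lebesgue (ball (p i) (r / 3)) \<noteq> \<infinity>" for i
      using fmeasurableD2[OF lmeasurable_ball] by simp
    show "disjoint_family_on (\<lambda>i. ball (p i) (r / 3)) K"
      unfolding disjoint_family_on_def using pa disjoint_ballI[OF disj] by blast
  qed
  also have "\<dots> \<le> measure lebesgue (ball c (5 / 3 * r))"
    by (rule measure_mono_fmeasurable) (use pc fin in auto)
  also have "\<dots> = 125 * (4 / 3 * (r / 3) ^ 3 * pi)"
    using r by (subst vol) (simp_all add: power_divide power_mult_distrib)
  finally have "real (card K) \<le> 125" using r by simp
  then show ?thesis by simp
qed

lemma neighbour_caps_gap: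
  obtains \<delta> where "\<delta> > 0" "\<And>c (a :: 'i \<Rightarrow> real ^ 3) r s K.
    \<lbrakk>r > 0; finite K; \<And>i. i \<in> K \<Longrightarrow> 0 < s i; \<And>i. i \<in> K \<Longrightarrow> dist c (a i) = r + s i;
     \<And>i j. \<lbrakk>i \<in> K; j \<in> K; i \<noteq> j\<rbrakk> \<Longrightarrow> s i + s j \<le> dist (a i) (a j)\<rbrakk>
    \<Longrightarrow> (\<Sum>i\<in>K. max 0 ((1 - cap_height r (s i)) / 2)) \<le> 1 - \<delta>"
proof (rule disjoint_caps_gap[where ?h0.0 = "1 / sqrt 3" and 'n = 125 and 'i = 'i])
  show "0 < 1 / sqrt 3" "1 / sqrt 3 \<le> (1::real)" by simp_all
next
  fix \<delta> :: real
  assume \<delta>: "\<delta> > 0" and gap: "\<And>(K :: 'i set) (u :: 'i \<Rightarrow> real ^ 3) h.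
    \<lbrakk>finite K; card K \<le> CARD(125); \<And>i. i \<in> K \<Longrightarrow> norm (u i) = 1; \<And>i. i \<in> K \<Longrightarrow> 1 / sqrt 3 \<le> h i;
     \<And>i. i \<in> K \<Longrightarrow> h i \<le> 1;
     \<And>i j. \<lbrakk>i \<in> K; j \<in> K; i \<noteq> j\<rbrakk> \<Longrightarrow> sector (u i) (h i) \<inter> sector (u j) (h j) = {}\<rbrakk>
    \<Longrightarrow> (\<Sum>i\<in>K. (1 - h i) / 2) \<le> 1 - \<delta>"
  show ?thesis
  proof (rule that[OF \<delta>])
    fix c and a :: "'i \<Rightarrow> real ^ 3" and r s K
    assume r: "r > 0" and fin: "finite K" and s: "\<And>i. i \<in> K \<Longrightarrow> 0 < s i"
      and d: "\<And>i. i \<in> K \<Longrightarrow> dist c (a i) = r + s i"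
      and disj: "\<And>i j. \<lbrakk>i \<in> K; j \<in> K; i \<noteq> j\<rbrakk> \<Longrightarrow> s i + s j \<le> dist (a i) (a j)"
    \<comment> \<open>Neighbours outside \<open>L\<close> do not cut the sphere and contribute 0.
      Those in \<open>L\<close> number at most 125, which is why the index type \<open>125\<close>
      was chosen.\<close>
    define L where "L = {i \<in> K. cap_height r (s i) < 1}"
    have L: "i \<in> K" "cap_height r (s i) < 1" if "i \<in> L" for i using that by (auto simp: L_def)
    have finL: "finite L" using fin by (simp add: L_def)
    have "(\<Sum>i\<in>K. max 0 ((1 - cap_height r (s i)) / 2)) = (\<Sum>i\<in>L. max 0 ((1 - cap_height r (s i)) / 2))"
      by (rule sum.mono_neutral_right) (auto simp: L_def fin max_def split: if_splits)
    also have "\<dots> = (\<Sum>i\<in>L. (1 - cap_height r (s i)) / 2)"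
      by (rule sum.cong) (auto simp: L_def)
    also have "\<dots> \<le> 1 - \<delta>"
    proof (rule gap[of L "\<lambda>i. (1 / (r + s i)) *\<^sub>R (a i - c)", OF finL])
      show "card L \<le> CARD(125)"
        using card_large_neighbours_le[OF r finL, of s c a] L cap_height_less_1D[OF r s] d disj by simp
      show "norm ((1 / (r + s i)) *\<^sub>R (a i - c)) = 1" if "i \<in> L" for i
        using d[OF L(1)[OF that]] s[OF L(1)[OF that]] r by (simp add: dist_norm norm_minus_commute)
      show "1 / sqrt 3 \<le> cap_height r (s i)" if "i \<in> L" for i
        by (rule cap_height_ge[OF r s[OF L(1)[OF that]]])
      show "cap_height r (s i) \<le> 1" if "i \<in> L" for i
        using L(2)[OF that] by simp
      show "sector ((1 / (r + s i)) *\<^sub>R (a i - c)) (cap_height r (s i)) \<inter>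
          sector ((1 / (r + s j)) *\<^sub>R (a j - c)) (cap_height r (s j)) = {}"
        if ij: "i \<in> L" "j \<in> L" "i \<noteq> j" for i j
      proof -
        have K: "i \<in> K" "j \<in> K" using ij L by auto
        have "ball (a i) (s i) \<inter> ball (a j) (s j) = {}"
          by (rule disjoint_ballI[OF disj[OF K ij(3)]])
        then show ?thesis
          using sector_shadow[OF r s[OF K(1)] d[OF K(1)]] sector_shadow[OF r s[OF K(2)] d[OF K(2)]] by blast
      qed
    qed
    finally show "(\<Sum>i\<in>K. max 0 ((1 - cap_height r (s i)) / 2)) \<le> 1 - \<delta>" .
  qed
qed

section \<open>The upper bound\<close>

text \<open>Double counting of the covered fractions: each ball offers at most
  \<open>1 - \<delta>\<close>, and the two caps belonging to a tangency use at least
  \<open>1 - sqrt 3 / 2\<close>.\<close>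

lemma average_kissing_number_gap:
  obtains \<epsilon> where "\<epsilon> > 0"
    "\<And>P. \<lbrakk>finite P; P \<noteq> {}; ball_packing P\<rbrakk> \<Longrightarrow> average_kissing_number P \<le> 8 + 4 * sqrt 3 - \<epsilon>"
proof (rule neighbour_caps_gap[where 'i = "(real ^ 3) set"])
  fix \<delta> :: real
  assume \<delta>: "\<delta> > 0" and gap: "\<And>c (a :: (real ^ 3) set \<Rightarrow> real ^ 3) r s K.
    \<lbrakk>r > 0; finite K; \<And>i. i \<in> K \<Longrightarrow> 0 < s i; \<And>i. i \<in> K \<Longrightarrow> dist c (a i) = r + s i;
     \<And>i j. \<lbrakk>i \<in> K; j \<in> K; i \<noteq> j\<rbrakk> \<Longrightarrow> s i + s j \<le> dist (a i) (a j)\<rbrakk>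
    \<Longrightarrow> (\<Sum>i\<in>K. max 0 ((1 - cap_height r (s i)) / 2)) \<le> 1 - \<delta>"
  \<comment> \<open>\<open>8 + 4 * sqrt 3\<close> is the quotient of 2 by
    \<open>1 - sqrt 3 / 2\<close>; the 2 arises because a tangency consists of two ordered
    pairs.\<close>
  have q: "(1 - sqrt 3 / 2) * (8 + 4 * sqrt 3) = 2"
    by (simp add: algebra_simps)
  show thesis
  proof (rule that[of "\<delta> * (8 + 4 * sqrt 3)"])
    show "0 < \<delta> * (8 + 4 * sqrt 3)" using \<delta> by (intro mult_pos_pos add_pos_nonneg) auto
    fix P assume P: "finite P" "P \<noteq> {}" "ball_packing P"
    then have "\<forall>B\<in>P. \<exists>x r. r > 0 \<and> B = cball x r" by (simp add: ball_packing_def)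
    then obtain x r where xr: "\<And>B. B \<in> P \<Longrightarrow> r B > 0 \<and> B = cball (x B) (r B)" by metis
    have dist_ge: "r A + r B \<le> dist (x A) (x B)" if AB: "A \<in> P" "B \<in> P" "A \<noteq> B" for A B
    proof -
      have "interior A \<inter> interior B = {}"
        using P(3) AB by (simp add: ball_packing_def pairwise_def)
      then have "interior (cball (x A) (r A)) \<inter> interior (cball (x B) (r B)) = {}"
        using xr[OF AB(1)] xr[OF AB(2)] by simp
      then show ?thesis using disjoint_interior_cball_iff xr AB by blast
    qed
    define N where "N A = {B \<in> P. A \<noteq> B \<and> A \<inter> B \<noteq> {}}" for A
    have dist_eq: "dist (x A) (x B) = r A + r B" if AB: "A \<in> P" "B \<in> N A" for A B
    proof -
      have B: "B \<in> P" "A \<noteq> B" "A \<inter> B \<noteq> {}" using AB by (auto simp: N_def)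
      then have "cball (x A) (r A) \<inter> cball (x B) (r B) \<noteq> {}"
        using xr[OF AB(1)] xr[OF B(1)] by simp
      then have "\<not> r A + r B < dist (x A) (x B)"
        using cball_Int_cball_eq_empty_iff xr AB(1) B(1) by blast
      then show ?thesis using dist_ge[OF AB(1) B(1,2)] by simp
    qed
    let ?f = "\<lambda>A B. max 0 ((1 - cap_height (r A) (r B)) / 2)"
    have N: "finite (N A)" for A using P(1) by (simp add: N_def)
    have "(\<Sum>A\<in>P. \<Sum>B\<in>N A. ?f A B) \<le> (\<Sum>A\<in>P. 1 - \<delta>)"
    proof (rule sum_mono)
      fix A assume A: "A \<in> P"
      show "(\<Sum>B\<in>N A. ?f A B) \<le> 1 - \<delta>"
      proof (rule gap[of "r A" "N A" r "x A" x])
        show "0 < r A" using xr A by blast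
        show "0 < r B" if "B \<in> N A" for B using xr that by (simp add: N_def)
        show "dist (x A) (x B) = r A + r B" if "B \<in> N A" for B using dist_eq A that .
        show "r B + r C \<le> dist (x B) (x C)" if "B \<in> N A" "C \<in> N A" "B \<noteq> C" for B C
          using dist_ge that by (simp add: N_def)
      qed (rule N)
    qed
    then have upper: "(\<Sum>A\<in>P. \<Sum>B\<in>N A. ?f A B) \<le> real (card P) * (1 - \<delta>)" by simp
    define R where "R = {(A, B). A \<in> P \<and> B \<in> P \<and> A \<noteq> B \<and> A \<inter> B \<noteq> {}}"
    have R: "R = Sigma P N" unfolding R_def N_def by blast
    have S1: "(\<Sum>A\<in>P. \<Sum>B\<in>N A. ?f A B) = (\<Sum>(A, B)\<in>R. ?f A B)"
      unfolding R using P(1) N by (simp add: sum.Sigma)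
    have swap: "prod.swap p \<in> R" if "p \<in> R" for p
      using that unfolding R_def
      by (cases p) (simp only: prod.swap_def fst_conv snd_conv mem_Collect_eq prod.case, blast)
    have S2: "(\<Sum>(A, B)\<in>R. ?f A B) = (\<Sum>(A, B)\<in>R. ?f B A)"
      by (rule sum.reindex_bij_witness[where i = prod.swap and j = prod.swap])
        (simp_all add: swap split_beta)
    have "real (card R) * (1 - sqrt 3 / 2) = (\<Sum>(A, B)\<in>R. 1 - sqrt 3 / 2)" by simp
    also have "\<dots> \<le> (\<Sum>(A, B)\<in>R. ?f A B + ?f B A)"
    proof (rule sum_mono, clarify)
      fix A B assume "(A, B) \<in> R"
      then have "cap_height (r A) (r B) + cap_height (r B) (r A) = sqrt 3"
        using xr by (intro cap_height_add) (auto simp only: R_def)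
      then have "1 - sqrt 3 / 2 = (1 - cap_height (r A) (r B)) / 2 + (1 - cap_height (r B) (r A)) / 2"
        by (simp add: field_simps)
      also have "\<dots> \<le> ?f A B + ?f B A" by (intro add_mono max.cobounded2)
      finally show "1 - sqrt 3 / 2 \<le> ?f A B + ?f B A" .
    qed
    also have "\<dots> = (\<Sum>(A, B)\<in>R. ?f A B) + (\<Sum>(A, B)\<in>R. ?f B A)"
      unfolding case_prod_unfold by (rule sum.distrib)
    also have "\<dots> \<le> 2 * (real (card P) * (1 - \<delta>))" using upper S1 S2 by linarith
    finally have *: "real (card R) * (1 - sqrt 3 / 2) \<le> 2 * (real (card P) * (1 - \<delta>))" .
    have "real (card R) * 2 = real (card R) * (1 - sqrt 3 / 2) * (8 + 4 * sqrt 3)"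
      by (simp only: mult.assoc q)
    also have "\<dots> \<le> 2 * (real (card P) * (1 - \<delta>)) * (8 + 4 * sqrt 3)"
      using * by (rule mult_right_mono) simp
    also have "\<dots> = real (card P) * ((1 - \<delta>) * (8 + 4 * sqrt 3)) * 2"
      by (simp only: ac_simps)
    finally have "real (card R) \<le> real (card P) * ((1 - \<delta>) * (8 + 4 * sqrt 3))"
      by (rule mult_right_le_imp_le) simp
    moreover have "average_kissing_number P = real (card R) / real (card P)"
      unfolding average_kissing_number_def R_def card_ordered_tangencies[OF P(1)] by simp
    moreover have "real (card P) > 0" using P by (simp add: card_gt_0_iff)
    ultimately have "average_kissing_number P \<le> (1 - \<delta>) * (8 + 4 * sqrt 3)"
      by (simp only: pos_divide_le_eq mult.commute)
    then show "average_kissing_number P \<le> 8 + 4 * sqrt 3 - \<delta> * (8 + 4 * sqrt 3)"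
      by (simp only: left_diff_distrib mult_1)
  qed
qed

text \<open>\<open>\<epsilon>\<close> is the same for all packings, so strictness survives the
  passage to the supremum.\<close>

lemma sup_average_kissing_number_less:
  "sup_average_kissing_number < ereal (8 + 4 * sqrt 3)"
proof (rule average_kissing_number_gap)
  fix \<epsilon> :: real
  assume \<epsilon>: "\<epsilon> > 0" and le: "\<And>P. \<lbrakk>finite P; P \<noteq> {}; ball_packing P\<rbrakk> \<Longrightarrow>
    average_kissing_number P \<le> 8 + 4 * sqrt 3 - \<epsilon>"
  have "sup_average_kissing_number \<le> ereal (8 + 4 * sqrt 3 - \<epsilon>)"
    unfolding sup_average_kissing_number_def
  proof (rule Sup_least)
    fix k assume "k \<in> {ereal (average_kissing_number P) |P. finite P \<and> P \<noteq> {} \<and> ball_packing P}"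
    then obtain P where "k = ereal (average_kissing_number P)" "finite P" "P \<noteq> {}" "ball_packing P"
      by blast
    then show "k \<le> ereal (8 + 4 * sqrt 3 - \<epsilon>)" using le[of P] by simp
  qed
  also have "\<dots> < ereal (8 + 4 * sqrt 3)" using \<epsilon> by simp
  finally show ?thesis .
qed

section \<open>The 600-cell\<close>

text \<open>\<open>(a, b)\<close> encodes \<open>a + b * \<phi>\<close> with \<open>\<phi>\<close> the golden ratio, and a \<open>quad\<close> consists of twice the
  coordinates of a point of the 3-sphere, so that unit vectors have inner product \<open>4\<close>.\<close>

type_synonym zphi = "int \<times> int"
type_synonym quad = "zphi \<times> zphi \<times> zphi \<times> zphi"

text \<open>Multiplication reduced by \<phi>^2 = \<phi> + 1.\<close>

definition zphi_mult :: "zphi \<Rightarrow> zphi \<Rightarrow> zphi" where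
  "zphi_mult x y = (case (x, y) of ((a, b), (c, d)) \<Rightarrow> (a * c + b * d, a * d + b * c + b * d))"

definition zphi_add :: "zphi \<Rightarrow> zphi \<Rightarrow> zphi" where
  "zphi_add x y = (fst x + fst y, snd x + snd y)"

definition quad_inner :: "quad \<Rightarrow> quad \<Rightarrow> zphi" where
  "quad_inner u v = (case (u, v) of ((a, b, c, d), (a', b', c', d')) \<Rightarrow>
     zphi_add (zphi_add (zphi_mult a a') (zphi_mult b b')) (zphi_add (zphi_mult c c') (zphi_mult d d')))"

definition signs :: "zphi \<Rightarrow> zphi list" where
  "signs x = [x, (- fst x, - snd x)]"

text \<open>The Klein four-group combined with the cyclic shifts of the last three entries gives the
  alternating group on four letters.\<close>

definition even_perms :: "'a \<times> 'a \<times> 'a \<times> 'a \<Rightarrow> ('a \<times> 'a \<times> 'a \<times> 'a) list" where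
  "even_perms = (\<lambda>(a, b, c, d). concat (map (\<lambda>(p, q, r, s). [(p, q, r, s), (q, p, s, r), (r, s, p, q), (s, r, q, p)])
     [(a, b, c, d), (a, c, d, b), (a, d, b, c)]))"

text \<open>The usual 8 + 16 + 96 vertices, doubled; \<open>(-1, 1)\<close> is the inverse of
  \<phi>.\<close>

definition cell600 :: "quad list" where
  "cell600 =
    concat (map (\<lambda>x. [(x, (0, 0), (0, 0), (0, 0)), ((0, 0), x, (0, 0), (0, 0)),
      ((0, 0), (0, 0), x, (0, 0)), ((0, 0), (0, 0), (0, 0), x)]) (signs (2, 0)))
    @ [(a, b, c, d). a \<leftarrow> signs (1, 0), b \<leftarrow> signs (1, 0), c \<leftarrow> signs (1, 0), d \<leftarrow> signs (1, 0)]
    @ concat (map even_perms [(a, b, c, (0, 0)). a \<leftarrow> signs (0, 1), b \<leftarrow> signs (1, 0), c \<leftarrow> signs (-1, 1)])"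

text \<open>The caps are centred at the vertices; the poles are \<open>(2, 0, 0, 0)\<close> and its antipode. The layer with
  first coordinate \<open>\<phi>\<close> is left out because it is the image of the layer with first coordinate
  \<open>-\<phi>\<close> of the preceding copy.\<close>

definition block :: "quad list" where
  "block = filter (\<lambda>u. fst u \<notin> {(2, 0), (-2, 0), (0, 1)}) cell600"

text \<open>All values of the inner product below \<open>2 * \<phi>\<close>, the value at neighbouring vertices.\<close>

definition small_inner :: "zphi list" where
  "small_inner = [(-4, 0), (0, -2), (-2, 0), (2, -2), (0, 0), (-2, 2), (2, 0)]"

text \<open>On the layer with first coordinate -\<phi> this is the reflection in the equator, onto
  the omitted layer.\<close>

definition flip :: "quad \<Rightarrow> quad" where
  "flip u = ((0, 1), snd u)"

lemma block_length: "length block = 106 \<and> distinct block"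
  by code_simp

lemma block_inner_self:
  "\<forall>u\<in>set block. quad_inner u u = (4, 0) \<and> fst u \<in> {(0, -1), (-1, 0), (1, -1), (0, 0), (-1, 1), (1, 0)}"
  by code_simp

lemma block_inner:
  "\<forall>u\<in>set block. \<forall>v\<in>set block. u = v \<or> quad_inner u v = (0, 2) \<or> quad_inner u v \<in> set small_inner"
  by code_simp

lemma block_inner_flip:
  "\<forall>u\<in>set block. fst u = (0, -1) \<longrightarrow> quad_inner (flip u) (flip u) = (4, 0) \<and>
    (\<forall>v\<in>set block. quad_inner (flip u) v = (0, 2) \<or> quad_inner (flip u) v \<in> set small_inner)"
  by code_simp

text \<open>Both orders are counted, so there are 594 edges: the 720 of the 600-cell without 12 at
  each pole, 30 inside the omitted layer and 72 from it to the next layer.\<close>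

lemma block_edges:
  "(\<Sum>u\<leftarrow>block. length (filter (\<lambda>v. quad_inner u v = (0, 2)) block)) = 1188"
  by code_simp

text \<open>Each of the 12 vertices of the omitted layer has 6 neighbours in the block. These edges
  join consecutive copies, and 594 + 72 = 666.\<close>

lemma block_flip_edges:
  "(\<Sum>u\<leftarrow>filter (\<lambda>u. fst u = (0, -1)) block. length (filter (\<lambda>v. quad_inner (flip u) v = (0, 2)) block)) = 72"
  by code_simp

section \<open>Stereographic projection of the 600-cell\<close>

definition golden :: real where
  "golden = (1 + sqrt 5) / 2"

definition kappa :: real where
  "kappa = sqrt (2 + golden)"

definition zval :: "zphi \<Rightarrow> real" where
  "zval x = of_int (fst x) + of_int (snd x) * golden"

lemma golden_square: "golden\<^sup>2 = golden + 1"
  by (simp add: golden_def power2_eq_square field_simps)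

lemma golden_bounds: "809 / 500 < golden" "golden < 16181 / 10000"
proof -
  have "2236 / 1000 < sqrt 5" by (rule real_less_rsqrt) (simp add: power2_eq_square)
  then show "809 / 500 < golden" by (simp add: golden_def)
  have "sqrt 5 < 22362 / 10000" by (rule real_less_lsqrt) (simp_all add: power2_eq_square)
  then show "golden < 16181 / 10000" by (simp add: golden_def)
qed

lemma kappa_square: "kappa\<^sup>2 = 2 + golden"
  using golden_bounds by (simp add: kappa_def)

lemma kappa_bounds: "19 / 10 < kappa" "kappa < 1903 / 1000"
proof -
  show "19 / 10 < kappa" unfolding kappa_def
    by (rule real_less_rsqrt) (use golden_bounds in \<open>simp add: power2_eq_square\<close>)
  show "kappa < 1903 / 1000" unfolding kappa_def
    by (rule real_less_lsqrt) (use golden_bounds in \<open>simp_all add: power2_eq_square\<close>)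
qed

lemma zval_add: "zval (zphi_add x y) = zval x + zval y"
  by (simp add: zval_def zphi_add_def algebra_simps)

lemma zval_mult: "zval (zphi_mult x y) = zval x * zval y"
proof -
  obtain a b c d where xy: "x = (a, b)" "y = (c, d)" by (cases x, cases y)
  have "zval x * zval y = of_int (a * c) + of_int (a * d + b * c) * golden + of_int (b * d) * golden\<^sup>2"
    by (simp add: xy zval_def algebra_simps power2_eq_square)
  then show ?thesis
    unfolding golden_square by (simp add: xy zval_def zphi_mult_def algebra_simps)
qed

definition lat :: "quad \<Rightarrow> real" where
  "lat u = zval (fst u)"

definition horiz :: "quad \<Rightarrow> real ^ 3" where
  "horiz u = vector [zval (fst (snd u)), zval (fst (snd (snd u))), zval (snd (snd (snd u)))]"

text \<open>Stereographic projection from \<open>(-2, 0, 0, 0)\<close> takes the cap of angular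
  radius \<alpha> about a unit vector (a, q) to the ball with centre q / (a + cos \<alpha>) and
  radius sin \<alpha> / (a + cos \<alpha>), provided that the denominator is positive. All
  coordinates are doubled here.\<close>

definition stereo_denom :: "quad \<Rightarrow> real" where
  "stereo_denom u = lat u + kappa"

definition stereo_center :: "quad \<Rightarrow> real ^ 3" where
  "stereo_center u = (1 / stereo_denom u) *\<^sub>R horiz u"

definition stereo_radius :: "quad \<Rightarrow> real" where
  "stereo_radius u = (golden - 1) / stereo_denom u"

lemma zval_quad_inner: "zval (quad_inner u v) = lat u * lat v + horiz u \<bullet> horiz v"
proof -
  obtain a b c d a' b' c' d' where uv: "u = (a, b, c, d)" "v = (a', b', c', d')"
    by (cases u, cases v)
  show ?thesis
    by (simp add: uv quad_inner_def zval_add zval_mult lat_def horiz_def inner_vec_def sum_3 vector_3)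
qed

text \<open>The caps have angular radius \<open>pi / 10\<close>, with cosine \<open>kappa / 2\<close> and sine \<open>(golden - 1) / 2\<close>.\<close>

lemma stereo_dist:
  assumes u: "quad_inner u u = (4, 0)" "stereo_denom u > 0"
    and v: "quad_inner v v = (4, 0)" "stereo_denom v > 0"
  shows "(dist (stereo_center u) (stereo_center v))\<^sup>2 = (stereo_radius u + stereo_radius v)\<^sup>2 +
    2 * (2 * golden - zval (quad_inner u v)) / (stereo_denom u * stereo_denom v)"
proof -
  define d e p q a b where "d = stereo_denom u" "e = stereo_denom v" "p = horiz u" "q = horiz v"
    "a = lat u" "b = lat v"
  note defs = this
  define D where "D = zval (quad_inner u v)"
  have de: "d > 0" "e > 0" "d = a + kappa" "e = b + kappa"
    using u v by (simp_all add: defs stereo_denom_def)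
  have pp: "p \<bullet> p = 4 - a\<^sup>2" using zval_quad_inner[of u u] u
    by (simp add: defs zval_def power2_eq_square)
  have qq: "q \<bullet> q = 4 - b\<^sup>2" using zval_quad_inner[of v v] v
    by (simp add: defs zval_def power2_eq_square)
  have pq: "p \<bullet> q = D - a * b" using zval_quad_inner[of u v]
    by (simp add: defs D_def)
  have sig: "(golden - 1)\<^sup>2 = 2 - golden"
    using golden_square by (simp add: power2_eq_square algebra_simps)
  have "stereo_center u - stereo_center v = (1 / (d * e)) *\<^sub>R (e *\<^sub>R p - d *\<^sub>R q)"
    using de by (simp add: stereo_center_def defs scaleR_diff_right)
  then have "(dist (stereo_center u) (stereo_center v))\<^sup>2 = (1 / (d * e))\<^sup>2 * (norm (e *\<^sub>R p - d *\<^sub>R q))\<^sup>2"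
    by (simp add: dist_norm power_mult_distrib power_divide)
  also have "(norm (e *\<^sub>R p - d *\<^sub>R q))\<^sup>2 = e\<^sup>2 * (p \<bullet> p) - 2 * d * e * (p \<bullet> q) + d\<^sup>2 * (q \<bullet> q)"
    unfolding power2_norm_eq_inner
    by (simp add: inner_diff_left inner_diff_right inner_commute[of q p] power2_eq_square algebra_simps)
  also have "\<dots> = (golden - 1)\<^sup>2 * (d + e)\<^sup>2 + d * e * (2 * (2 * golden - D))"
  proof -
    \<comment> \<open>With \<open>kappa\<close> twice the cosine of pi / 10, these are sin^2 = 1 -
      cos^2 and the double angle formula. What remains is a polynomial identity.\<close>
    have g: "2 - golden = 4 - kappa\<^sup>2" "2 * golden = 2 * kappa\<^sup>2 - 4" by (simp_all add: kappa_square)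
    show ?thesis unfolding pp qq pq sig de(3,4) g by algebra
  qed
  also have "(1 / (d * e))\<^sup>2 * ((golden - 1)\<^sup>2 * (d + e)\<^sup>2 + d * e * (2 * (2 * golden - D))) =
      ((golden - 1) / d + (golden - 1) / e)\<^sup>2 + 2 * (2 * golden - D) / (d * e)"
  proof -
    have "(golden - 1) / d + (golden - 1) / e = (golden - 1) * (d + e) * (1 / (d * e))"
      using de(1,2) by (simp add: divide_simps) (simp add: algebra_simps)
    then have e1: "((golden - 1) / d + (golden - 1) / e)\<^sup>2 = (1 / (d * e))\<^sup>2 * ((golden - 1)\<^sup>2 * (d + e)\<^sup>2)"
      by (metis mult.commute power_mult_distrib)
    have e2: "x / (d * e) = (1 / (d * e))\<^sup>2 * (d * e * x)" for x
      using de(1,2) by (simp add: power2_eq_square)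
    show ?thesis unfolding e1 by (subst e2[of "2 * (2 * golden - D)"]) (rule distrib_left)
  qed
  finally show ?thesis by (simp only: stereo_radius_def defs D_def)
qed

lemma small_inner_le: "x \<in> set small_inner \<Longrightarrow> zval x \<le> 2 * golden"
  using golden_bounds by (auto simp: small_inner_def zval_def)

lemma zval_edge: "zval (0, 2) = 2 * golden"
  by (simp add: zval_def)

lemma stereo_radius_pos: "stereo_denom u > 0 \<Longrightarrow> stereo_radius u > 0"
  using golden_bounds by (simp add: stereo_radius_def)

text \<open>Inner product \<open>2 * golden\<close> makes the correction term of
  \<open>stereo_dist\<close> vanish, so neighbouring vertices give tangent balls; a smaller inner
  product makes it positive.\<close>

lemma stereo_dist_eq:
  assumes "quad_inner u u = (4, 0)" "stereo_denom u > 0"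
    and "quad_inner v v = (4, 0)" "stereo_denom v > 0" and "quad_inner u v = (0, 2)"
  shows "dist (stereo_center u) (stereo_center v) = stereo_radius u + stereo_radius v"
proof (rule power2_eq_imp_eq)
  show "(dist (stereo_center u) (stereo_center v))\<^sup>2 = (stereo_radius u + stereo_radius v)\<^sup>2"
    unfolding stereo_dist[OF assms(1-4)] assms(5) zval_edge by simp
qed (use stereo_radius_pos[OF assms(2)] stereo_radius_pos[OF assms(4)] in auto)

lemma stereo_dist_ge:
  assumes "quad_inner u u = (4, 0)" "stereo_denom u > 0"
    and "quad_inner v v = (4, 0)" "stereo_denom v > 0"
    and "quad_inner u v = (0, 2) \<or> quad_inner u v \<in> set small_inner"
  shows "stereo_radius u + stereo_radius v \<le> dist (stereo_center u) (stereo_center v)"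
proof (rule power2_le_imp_le)
  have "zval (quad_inner u v) \<le> 2 * golden"
    using assms(5) small_inner_le zval_edge by (metis order_refl)
  then show "(stereo_radius u + stereo_radius v)\<^sup>2 \<le> (dist (stereo_center u) (stereo_center v))\<^sup>2"
    unfolding stereo_dist[OF assms(1-4)] using assms(2,4) by simp
qed simp

definition scale :: real where
  "scale = (kappa + golden) / (kappa - golden)"

lemma scale_ge: "12 \<le> scale"
  using golden_bounds kappa_bounds by (simp add: scale_def pos_le_divide_eq)

text \<open>The layers at \<phi> and -\<phi> have the same horizontal parts, so their projections
  differ only by the ratio of the two denominators, which is \<open>scale\<close>.\<close>

lemma flip_scale:
  assumes "fst u = (0, -1)"
  shows "stereo_center u = scale *\<^sub>R stereo_center (flip u)"
    and "stereo_radius u = scale * stereo_radius (flip u)"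
    and "stereo_denom (flip u) > 0"
proof -
  have d: "stereo_denom u = kappa - golden" "stereo_denom (flip u) = kappa + golden" "horiz (flip u) = horiz u"
    using assms by (simp_all add: stereo_denom_def lat_def zval_def flip_def horiz_def)
  have pos: "kappa - golden > 0" "kappa + golden > 0" using golden_bounds kappa_bounds by simp_all
  then show "stereo_denom (flip u) > 0" by (simp add: d)
  have "scale / (kappa + golden) = 1 / (kappa - golden)" using pos by (simp add: scale_def)
  then show "stereo_center u = scale *\<^sub>R stereo_center (flip u)"
    by (simp add: stereo_center_def d)
  show "stereo_radius u = scale * stereo_radius (flip u)"
    using pos by (simp add: stereo_radius_def d scale_def)
qed

text \<open>One copy lies in the shell between the radii \<open>1 / 4\<close> and 10, and within
  radius 3 apart from its outermost layer. As \<open>scale\<close> is at least 12, these crude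
  bounds separate all pairs of balls in different copies except those involving the shared
  layer.\<close>

lemma block_bounds:
  assumes u: "u \<in> set block"
  shows "quad_inner u u = (4, 0)" "stereo_denom u > 0"
    and "1 / 4 \<le> norm (stereo_center u) - stereo_radius u"
    and "norm (stereo_center u) + stereo_radius u \<le> 10"
    and "fst u \<noteq> (0, -1) \<Longrightarrow> norm (stereo_center u) + stereo_radius u \<le> 3"
proof -
  note gk = golden_bounds kappa_bounds
  show q: "quad_inner u u = (4, 0)" using block_inner_self u by blast
  have f: "fst u \<in> {(0, -1), (-1, 0), (1, -1), (0, 0), (-1, 1), (1, 0)}" using block_inner_self u by blast
  have lat: "lat u = - golden \<or> (- 1 \<le> lat u \<and> lat u \<le> 0) \<or> (0 \<le> lat u \<and> lat u \<le> 1)"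
    using f gk by (auto simp: lat_def zval_def)
  have lat': "fst u \<noteq> (0, -1) \<Longrightarrow> - 1 \<le> lat u"
    using f gk by (auto simp: lat_def zval_def)
  have n: "(norm (horiz u))\<^sup>2 = 4 - (lat u)\<^sup>2"
    unfolding power2_norm_eq_inner using zval_quad_inner[of u u] q by (simp add: zval_def power2_eq_square)
  have n2: "norm (horiz u) \<le> 2" by (rule power2_le_imp_le) (simp_all add: n)
  have d: "stereo_denom u = lat u + kappa" by (simp add: stereo_denom_def)
  show pos: "stereo_denom u > 0" using lat gk d by auto
  have c: "norm (stereo_center u) = norm (horiz u) / stereo_denom u"
    using pos by (simp add: stereo_center_def)
  have plus: "norm (stereo_center u) + stereo_radius u = (norm (horiz u) + (golden - 1)) / stereo_denom u"
    by (simp add: c stereo_radius_def add_divide_distrib diff_divide_distrib)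
  have minus: "norm (stereo_center u) - stereo_radius u = (norm (horiz u) - (golden - 1)) / stereo_denom u"
    by (simp add: c stereo_radius_def add_divide_distrib diff_divide_distrib)
  show "norm (stereo_center u) + stereo_radius u \<le> 10"
    unfolding plus using pos n2 lat gk d by (auto simp: pos_divide_le_eq)
  show "norm (stereo_center u) + stereo_radius u \<le> 3" if "fst u \<noteq> (0, -1)"
    unfolding plus using pos n2 lat'[OF that] gk d by (auto simp: pos_divide_le_eq)
  \<comment> \<open>For nonpositive latitude the squared horizontal norm is at least
    \<open>3 - golden\<close>, which exceeds \<open>(117 / 100)\<^sup>2\<close>; for positive
    latitude it is at least 3, which exceeds \<open>(17 / 10)\<^sup>2\<close>.\<close>
  have "stereo_denom u / 4 \<le> norm (horiz u) - (golden - 1)"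
  proof (cases "lat u \<le> 0")
    case True
    have "(lat u)\<^sup>2 \<le> golden\<^sup>2" using lat True gk by (subst abs_le_square_iff[symmetric]) auto
    then have "(117 / 100)\<^sup>2 \<le> (norm (horiz u))\<^sup>2"
      unfolding n golden_square using gk by (simp add: power2_eq_square)
    then have "117 / 100 \<le> norm (horiz u)" by (rule power2_le_imp_le) simp
    then show ?thesis using True gk unfolding d by argo
  next
    case False
    then have "lat u \<le> 1" using lat gk by auto
    then have "(lat u)\<^sup>2 \<le> 1" using False by (simp add: power_le_one)
    then have "(17 / 10)\<^sup>2 \<le> (norm (horiz u))\<^sup>2"
      unfolding n by (simp add: power2_eq_square)
    then have "17 / 10 \<le> norm (horiz u)" by (rule power2_le_imp_le) simp
    then show ?thesis using \<open>lat u \<le> 1\<close> gk unfolding d by argo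
  qed
  then show "1 / 4 \<le> norm (stereo_center u) - stereo_radius u"
    unfolding minus using pos by (simp add: pos_le_divide_eq)
qed

section \<open>The chain of copies\<close>

definition chain_center :: "nat \<times> quad \<Rightarrow> real ^ 3" where
  "chain_center = (\<lambda>(j, u). scale ^ j *\<^sub>R stereo_center u)"

definition chain_radius :: "nat \<times> quad \<Rightarrow> real" where
  "chain_radius = (\<lambda>(j, u). scale ^ j * stereo_radius u)"

definition chain_ball :: "nat \<times> quad \<Rightarrow> (real ^ 3) set" where
  "chain_ball x = cball (chain_center x) (chain_radius x)"

lemma scale_pos: "scale > 0"
  using scale_ge by simp

lemma dist_scale:
  "dist (scale ^ j *\<^sub>R (a :: real ^ 3)) (scale ^ j *\<^sub>R b) = scale ^ j * dist a b"
  using scale_pos by (simp add: dist_norm flip: scaleR_diff_right)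

lemma chain_radius_pos:
  assumes "u \<in> set block"
  shows "chain_radius (j, u) > 0"
  using stereo_radius_pos[OF block_bounds(2)[OF assms]] scale_pos by (simp add: chain_radius_def)

lemma chain_touch_level:
  assumes "u \<in> set block" "v \<in> set block" "quad_inner u v = (0, 2)"
  shows "dist (chain_center (j, u)) (chain_center (j, v)) = chain_radius (j, u) + chain_radius (j, v)"
  using stereo_dist_eq[OF block_bounds(1,2)[OF assms(1)] block_bounds(1,2)[OF assms(2)] assms(3)]
  by (simp add: chain_center_def chain_radius_def dist_scale distrib_left)

text \<open>The outermost layer of copy \<open>j\<close> is the omitted innermost layer of copy
  \<open>Suc j\<close>. A pair formed with the next copy can therefore be compared inside a single
  copy.\<close>

lemma chain_shift:
  assumes "fst u = (0, -1)"
  shows "chain_center (j, u) = chain_center (Suc j, flip u)"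
    and "chain_radius (j, u) = chain_radius (Suc j, flip u)"
  using flip_scale[OF assms] by (simp_all add: chain_center_def chain_radius_def mult.commute)

lemma chain_touch_next:
  assumes u: "u \<in> set block" "fst u = (0, -1)" and v: "v \<in> set block" and e: "quad_inner (flip u) v = (0, 2)"
  shows "dist (chain_center (j, u)) (chain_center (Suc j, v)) = chain_radius (j, u) + chain_radius (Suc j, v)"
proof -
  have "quad_inner (flip u) (flip u) = (4, 0)" using block_inner_flip u by blast
  from stereo_dist_eq[OF this flip_scale(3)[OF u(2)] block_bounds(1,2)[OF v] e]
  show ?thesis
    unfolding chain_shift[OF u(2)]
    by (simp only: chain_center_def chain_radius_def prod.case dist_scale distrib_left)
qed

lemma chain_disjoint_le:
  assumes u: "u \<in> set block" and v: "v \<in> set block" and jl: "j \<le> l" and ne: "(j, u) \<noteq> (l, v)"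
  shows "chain_radius (j, u) + chain_radius (l, v) \<le> dist (chain_center (j, u)) (chain_center (l, v))"
proof -
  \<comment> \<open>Separation by a sphere about the origin: copy \<open>l\<close> stays outside
    radius \<open>scale ^ l / 4\<close>.\<close>
  have sep: ?thesis if "norm (stereo_center u) + stereo_radius u \<le> scale ^ (l - j) * (1 / 4)"
  proof -
    have "chain_radius (j, u) + norm (chain_center (j, u)) = scale ^ j * (norm (stereo_center u) + stereo_radius u)"
      using scale_pos by (simp add: chain_radius_def chain_center_def distrib_left)
    also have "\<dots> \<le> scale ^ j * (scale ^ (l - j) * (1 / 4))"
      using that scale_pos by (intro mult_left_mono) auto
    also have "\<dots> = scale ^ l * (1 / 4)" using jl by (simp flip: power_add)
    also have "\<dots> \<le> scale ^ l * (norm (stereo_center v) - stereo_radius v)"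
      using block_bounds(3)[OF v] scale_pos by (intro mult_left_mono) auto
    also have "\<dots> = norm (chain_center (l, v)) - chain_radius (l, v)"
      using scale_pos by (simp add: chain_radius_def chain_center_def right_diff_distrib)
    finally show ?thesis
      using norm_triangle_ineq2[of "chain_center (l, v)" "chain_center (j, u)"]
      by (simp add: dist_norm norm_minus_commute)
  qed
  \<comment> \<open>Same copy; outermost layer against the next copy, moved into that copy by
    \<open>chain_shift\<close>; other layers against the next copy, by 3 \<le> 12 / 4; copies
    further apart, by 10 \<le> 144 / 4.\<close>
  consider "l = j" | "l = Suc j" "fst u = (0, -1)" | "l = Suc j" "fst u \<noteq> (0, -1)" | "Suc (Suc j) \<le> l"
    using jl by linarith
  then show ?thesis
  proof cases
    case 1
    then have "u \<noteq> v" using ne by simp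
    then have "quad_inner u v = (0, 2) \<or> quad_inner u v \<in> set small_inner"
      using block_inner u v by blast
    from stereo_dist_ge[OF block_bounds(1,2)[OF u] block_bounds(1,2)[OF v] this] scale_pos
    have "scale ^ j * (stereo_radius u + stereo_radius v) \<le> scale ^ j * dist (stereo_center u) (stereo_center v)"
      by (intro mult_left_mono) auto
    then show ?thesis
      unfolding 1 by (simp only: chain_center_def chain_radius_def prod.case dist_scale distrib_left)
  next
    case 2
    have q: "quad_inner (flip u) (flip u) = (4, 0)" using block_inner_flip u 2(2) by blast
    have "quad_inner (flip u) v = (0, 2) \<or> quad_inner (flip u) v \<in> set small_inner"
      using block_inner_flip u v 2(2) by blast
    from stereo_dist_ge[OF q flip_scale(3)[OF 2(2)] block_bounds(1,2)[OF v] this] scale_pos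
    have "scale ^ Suc j * (stereo_radius (flip u) + stereo_radius v) \<le>
        scale ^ Suc j * dist (stereo_center (flip u)) (stereo_center v)"
      by (intro mult_left_mono) auto
    then show ?thesis
      unfolding chain_shift[OF 2(2)] 2(1)
      by (simp only: chain_center_def chain_radius_def prod.case dist_scale distrib_left)
  next
    case 3
    have "norm (stereo_center u) + stereo_radius u \<le> scale * (1 / 4)"
      using block_bounds(5)[OF u 3(2)] scale_ge by simp
    then show ?thesis using 3(1) by (intro sep) simp
  next
    case 4
    have "12\<^sup>2 \<le> scale\<^sup>2" using scale_ge by (intro power_mono) auto
    also have "\<dots> \<le> scale ^ (l - j)"
      using 4 scale_ge by (intro power_increasing) auto
    finally have "10 \<le> scale ^ (l - j) * (1 / 4)" by simp
    then show ?thesis using block_bounds(4)[OF u] by (intro sep) linarith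
  qed
qed

lemma chain_disjoint:
  assumes "x \<in> UNIV \<times> set block" "y \<in> UNIV \<times> set block" "x \<noteq> y"
  shows "chain_radius x + chain_radius y \<le> dist (chain_center x) (chain_center y)"
proof -
  obtain j u l v where xy: "x = (j, u)" "y = (l, v)" by (cases x, cases y)
  show ?thesis
  proof (cases "j \<le> l")
    case True
    then show ?thesis using assms xy by (auto intro: chain_disjoint_le)
  next
    case False
    then have "chain_radius y + chain_radius x \<le> dist (chain_center y) (chain_center x)"
      using assms xy by (auto intro!: chain_disjoint_le)
    then show ?thesis by (simp add: dist_commute add.commute)
  qed
qed

section \<open>Counting the balls and tangencies of the chain\<close>

definition chain_packing :: "nat \<Rightarrow> (real ^ 3) set set" where
  "chain_packing n = chain_ball ` ({..n} \<times> set block)"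

lemma chain_ball_interior_disjoint:
  assumes "x \<in> UNIV \<times> set block" "y \<in> UNIV \<times> set block" "x \<noteq> y"
  shows "interior (chain_ball x) \<inter> interior (chain_ball y) = {}"
proof -
  have "chain_radius x > 0" "chain_radius y > 0"
    using assms chain_radius_pos by auto
  then show ?thesis
    unfolding chain_ball_def using disjoint_interior_cball_iff chain_disjoint[OF assms] by blast
qed

text \<open>Equal balls with disjoint interiors would have empty interior. Hence balls can be
  counted by their indices.\<close>

lemma inj_on_chain_ball: "inj_on chain_ball (UNIV \<times> set block)"
proof (rule inj_onI)
  fix x y assume xy: "x \<in> UNIV \<times> set block" "y \<in> UNIV \<times> set block" "chain_ball x = chain_ball y"
  show "x = y"
  proof (rule ccontr)
    assume "x \<noteq> y"
    from chain_ball_interior_disjoint[OF xy(1,2) this] xy(3)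
    have "interior (chain_ball x) = {}" by simp
    moreover have "chain_radius x > 0" using xy(1) chain_radius_pos by auto
    ultimately show False by (simp add: chain_ball_def interior_cball)
  qed
qed

lemma ball_packing_chain: "ball_packing (chain_packing n)"
  unfolding ball_packing_def
proof
  show "\<forall>B\<in>chain_packing n. \<exists>x r. 0 < r \<and> B = cball x r"
  proof
    fix B assume "B \<in> chain_packing n"
    then obtain j u where "B = chain_ball (j, u)" "u \<in> set block" by (auto simp: chain_packing_def)
    then show "\<exists>x r. 0 < r \<and> B = cball x r"
      using chain_radius_pos chain_ball_def by blast
  qed
  show "pairwise (\<lambda>A B. interior A \<inter> interior B = {}) (chain_packing n)"
  proof (rule pairwiseI)
    fix A B assume "A \<in> chain_packing n" "B \<in> chain_packing n" "A \<noteq> B"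
    then obtain x y where "A = chain_ball x" "B = chain_ball y" "x \<in> UNIV \<times> set block" "y \<in> UNIV \<times> set block" "x \<noteq> y"
      unfolding chain_packing_def by blast
    then show "interior A \<inter> interior B = {}" using chain_ball_interior_disjoint by simp
  qed
qed

lemma finite_chain: "finite (chain_packing n)"
  by (simp add: chain_packing_def)

lemma card_chain: "card (chain_packing n) = 106 * Suc n"
proof -
  have "card (set block) = 106" using block_length distinct_card by metis
  moreover have "card (chain_packing n) = card ({..n} \<times> set block)"
    unfolding chain_packing_def
    by (rule card_image) (rule inj_on_subset[OF inj_on_chain_ball], auto)
  ultimately show ?thesis by (simp add: card_cartesian_product)
qed

definition level_edges :: "(quad \<times> quad) set" where
  "level_edges = Sigma (set block) (\<lambda>u. {v \<in> set block. quad_inner u v = (0, 2)})"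

definition next_edges :: "(quad \<times> quad) set" where
  "next_edges = Sigma {u \<in> set block. fst u = (0, -1)} (\<lambda>u. {v \<in> set block. quad_inner (flip u) v = (0, 2)})"

lemma card_level_edges: "card level_edges = 1188"
proof -
  have d: "distinct block" using block_length by blast
  have len: "card {v \<in> set block. Q v} = length (filter Q block)" for Q
    using distinct_card[OF distinct_filter[OF d], of Q] by (simp only: set_filter)
  have "card level_edges = (\<Sum>u\<in>set block. card {v \<in> set block. quad_inner u v = (0, 2)})"
    unfolding level_edges_def by (rule card_SigmaI) auto
  also have "\<dots> = (\<Sum>u\<in>set block. length (filter (\<lambda>v. quad_inner u v = (0, 2)) block))"
    by (simp only: len)
  also have "\<dots> = (\<Sum>u\<leftarrow>block. length (filter (\<lambda>v. quad_inner u v = (0, 2)) block))"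
    using d by (rule sum_list_distinct_conv_sum_set[symmetric])
  also have "\<dots> = 1188" by (rule block_edges)
  finally show ?thesis .
qed

lemma card_next_edges: "card next_edges = 72"
proof -
  have d: "distinct block" using block_length by blast
  have len: "card {v \<in> set block. Q v} = length (filter Q block)" for Q
    using distinct_card[OF distinct_filter[OF d], of Q] by (simp only: set_filter)
  let ?ring = "filter (\<lambda>u. fst u = (0, -1)) block"
  have "card next_edges = (\<Sum>u\<in>set ?ring. card {v \<in> set block. quad_inner (flip u) v = (0, 2)})"
    unfolding next_edges_def set_filter by (rule card_SigmaI) auto
  also have "\<dots> = (\<Sum>u\<in>set ?ring. length (filter (\<lambda>v. quad_inner (flip u) v = (0, 2)) block))"
    by (simp only: len)
  also have "\<dots> = (\<Sum>u\<leftarrow>?ring. length (filter (\<lambda>v. quad_inner (flip u) v = (0, 2)) block))"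
    using d by (intro sum_list_distinct_conv_sum_set[symmetric] distinct_filter)
  also have "\<dots> = 72" by (rule block_flip_edges)
  finally show ?thesis .
qed

lemma chain_ball_touch:
  assumes "x \<in> {..n} \<times> set block" "y \<in> {..n} \<times> set block" "x \<noteq> y"
    and "dist (chain_center x) (chain_center y) = chain_radius x + chain_radius y"
  shows "(chain_ball x, chain_ball y) \<in>
    {(A, B). A \<in> chain_packing n \<and> B \<in> chain_packing n \<and> A \<noteq> B \<and> A \<inter> B \<noteq> {}}"
proof -
  have "chain_radius x > 0" "chain_radius y > 0"
    using assms chain_radius_pos by auto
  then have "chain_ball x \<inter> chain_ball y \<noteq> {}"
    unfolding chain_ball_def using cball_Int_cball_eq_empty_iff assms(4) by (metis less_irrefl)
  moreover have "chain_ball x \<noteq> chain_ball y"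
    using inj_onD[OF inj_on_chain_ball] assms by auto
  moreover have "chain_ball x \<in> chain_packing n" "chain_ball y \<in> chain_packing n"
    using assms by (simp_all only: chain_packing_def imageI)
  ultimately show ?thesis by blast
qed

text \<open>There are \<open>n + 1\<close> copies with 1188 ordered pairs each and \<open>n\<close>
  joins with 72 tangencies, each in two orders.\<close>

lemma card_tangencies_chain: "1332 * n + 1188 \<le> 2 * card (tangencies (chain_packing n))"
proof -
  define R where "R = {(A, B). A \<in> chain_packing n \<and> B \<in> chain_packing n \<and> A \<noteq> B \<and> A \<inter> B \<noteq> {}}"
  define I where "I = {..n} \<times> set block"
  \<comment> \<open>\<open>level_edges\<close> already contains both orders of each edge, whereas
    \<open>next_edges\<close> runs only outwards; hence the separate reversed set
    \<open>E3\<close>.\<close>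
  define E1 where "E1 = (\<lambda>(j :: nat, u, v). ((j, u), (j, v))) ` ({..n} \<times> level_edges)"
  define E2 where "E2 = (\<lambda>(j, u, v). ((j, u), (Suc j, v))) ` ({..<n} \<times> next_edges)"
  define E3 where "E3 = (\<lambda>(j, u, v). ((Suc j, v), (j, u))) ` ({..<n} \<times> next_edges)"
  have fin: "finite level_edges" "finite next_edges"
    by (simp_all add: level_edges_def next_edges_def)
  have "card E1 = card ({..n} \<times> level_edges)" unfolding E1_def
    by (rule card_image) (auto simp: inj_on_def)
  then have E1: "card E1 = 1188 * Suc n" by (simp add: card_cartesian_product card_level_edges)
  have "card E2 = card ({..<n} \<times> next_edges)" unfolding E2_def
    by (rule card_image) (auto simp: inj_on_def)
  then have E2: "card E2 = 72 * n" by (simp add: card_cartesian_product card_next_edges)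
  have "card E3 = card ({..<n} \<times> next_edges)" unfolding E3_def
    by (rule card_image) (auto simp: inj_on_def)
  then have E3: "card E3 = 72 * n" by (simp add: card_cartesian_product card_next_edges)
  have finE: "finite E1" "finite E2" "finite E3"
    using fin by (simp_all add: E1_def E2_def E3_def)
  \<comment> \<open>The copy number changes by 0, 1 and -1 from the first to the second entry in the
    three sets.\<close>
  have dis: "E1 \<inter> E2 = {}" "(E1 \<union> E2) \<inter> E3 = {}"
    unfolding E1_def E2_def E3_def by fastforce+
  have "card (E1 \<union> E2 \<union> E3) = card E1 + card E2 + card E3"
    using finE dis by (simp only: card_Un_disjoint finite_Un simp_thms)
  then have total: "card (E1 \<union> E2 \<union> E3) = 1332 * n + 1188"
    unfolding E1 E2 E3 by simp
  have mem: "x \<in> I \<and> y \<in> I \<and> (chain_ball x, chain_ball y) \<in> R" if E: "(x, y) \<in> E1 \<union> E2 \<union> E3" for x y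
  proof -
    from E consider
      (1) j u v where "x = (j, u)" "y = (j, v)" "j \<le> n" "(u, v) \<in> level_edges"
      | (2) j u v where "x = (j, u)" "y = (Suc j, v)" "j < n" "(u, v) \<in> next_edges"
      | (3) j u v where "x = (Suc j, v)" "y = (j, u)" "j < n" "(u, v) \<in> next_edges"
      unfolding E1_def E2_def E3_def by (elim UnE imageE SigmaE) auto
    then show ?thesis
    proof cases
      case 1
      then have uv: "u \<in> set block" "v \<in> set block" "quad_inner u v = (0, 2)" by (auto simp: level_edges_def)
      then have "u \<noteq> v" using block_inner_self by fastforce
      then show ?thesis unfolding R_def I_def
        using 1 uv chain_ball_touch[of x n y] chain_touch_level[OF uv] by auto
    next
      case 2
      then have uv: "u \<in> set block" "fst u = (0, -1)" "v \<in> set block" "quad_inner (flip u) v = (0, 2)"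
        by (auto simp: next_edges_def)
      then show ?thesis unfolding R_def I_def
        using 2 chain_ball_touch[of x n y] chain_touch_next[OF uv] by auto
    next
      case 3
      then have uv: "u \<in> set block" "fst u = (0, -1)" "v \<in> set block" "quad_inner (flip u) v = (0, 2)"
        by (auto simp: next_edges_def)
      then show ?thesis unfolding R_def I_def
        using 3 chain_ball_touch[of x n y] chain_touch_next[OF uv, of j] by (auto simp: dist_commute add.commute)
    qed
  qed
  have "inj_on (map_prod chain_ball chain_ball) (E1 \<union> E2 \<union> E3)"
  proof (rule inj_on_subset)
    show "inj_on (map_prod chain_ball chain_ball) (I \<times> I)"
      by (intro map_prod_inj_on inj_on_subset[OF inj_on_chain_ball]) (auto simp: I_def)
    show "E1 \<union> E2 \<union> E3 \<subseteq> I \<times> I" using mem by (intro subrelI SigmaI) simp_all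
  qed
  then have "card (E1 \<union> E2 \<union> E3) = card (map_prod chain_ball chain_ball ` (E1 \<union> E2 \<union> E3))"
    by (rule card_image[symmetric])
  also have "\<dots> \<le> card R"
  proof (rule card_mono)
    show "finite R"
      by (rule finite_subset[of _ "chain_packing n \<times> chain_packing n"]) (auto simp: R_def finite_chain)
    show "map_prod chain_ball chain_ball ` (E1 \<union> E2 \<union> E3) \<subseteq> R"
    proof (rule image_subsetI)
      fix p assume "p \<in> E1 \<union> E2 \<union> E3"
      then show "map_prod chain_ball chain_ball p \<in> R"
        using mem[of "fst p" "snd p"] by (simp add: map_prod_def split_beta)
    qed
  qed
  also have "\<dots> = 2 * card (tangencies (chain_packing n))"
    unfolding R_def by (rule card_ordered_tangencies[OF finite_chain])
  finally show ?thesis unfolding total .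
qed

text \<open>The innermost copy has no predecessor, which costs 72 tangencies, or 144 in the doubled
  count. The loss disappears in the limit.\<close>

lemma average_kissing_number_chain:
  "666 / 53 - 144 / (106 * real (Suc n)) \<le> average_kissing_number (chain_packing n)"
proof -
  have "666 / 53 - 144 / (106 * real (Suc n)) = (1332 * real n + 1188) / (106 * real (Suc n))"
    by (simp add: field_simps)
  also have "\<dots> \<le> average_kissing_number (chain_packing n)"
  proof -
    have "1332 * real n + 1188 \<le> 2 * real (card (tangencies (chain_packing n)))"
      using of_nat_mono[OF card_tangencies_chain[of n], where 'a = real] by simp
    then show ?thesis
      unfolding average_kissing_number_def card_chain of_nat_mult of_nat_numeral
      by (intro divide_right_mono) auto
  qed
  finally show ?thesis .
qed

lemma sup_average_kissing_number_ge: "ereal (666 / 53) \<le> sup_average_kissing_number"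
proof (rule LIMSEQ_le_const2)
  have "(\<lambda>n. 666 / 53 - 144 / (106 * real (Suc n))) \<longlonglongrightarrow> 666 / 53 - 0"
    by (intro tendsto_intros) real_asymp
  then show "(\<lambda>n. ereal (666 / 53 - 144 / (106 * real (Suc n)))) \<longlonglongrightarrow> ereal (666 / 53)"
    by simp
  have "ereal (666 / 53 - 144 / (106 * real (Suc n))) \<le> sup_average_kissing_number" for n
  proof -
    have "chain_packing n \<noteq> {}" using card_chain[of n] by force
    then have "ereal (average_kissing_number (chain_packing n)) \<le> sup_average_kissing_number"
      unfolding sup_average_kissing_number_def
      using finite_chain ball_packing_chain by (intro Sup_upper) blast
    then show ?thesis using average_kissing_number_chain[of n] by (meson ereal_less_eq(3) order_trans)
  qed
  then show "\<exists>N. \<forall>n\<ge>N. ereal (666 / 53 - 144 / (106 * real (Suc n))) \<le> sup_average_kissing_number"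
    by blast
qed

theorem theorem1:
  "ereal (666 / 53) \<le> sup_average_kissing_number \<and>
   sup_average_kissing_number < ereal (8 + 4 * sqrt 3)"
  using sup_average_kissing_number_ge sup_average_kissing_number_less by blast

end
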